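(* The class of $(\overline{P_1+P_3},\,P_1+S_{1,1,2})$-free graphs has bounded clique-width.
   Context: All graphs are finite, simple and undirected. For a family of graphs $\{H_1,\ldots,H_p\}$, a graph $G$ is $(H_1,\ldots,H_p)$-free if no induced subgraph of $G$ is isomorphic to any $H_i$. $P_r$ denotes the path on $r$ vertices; $G+H$ denotes the disjoint union of $G$ and $H$; $\overline{G}$ denotes the complement of $G$ (so $\overline{P_1+P_3}$ is the "paw": a triangle with a pendant vertex). For $1\le i\le j\le k$, $S_{i,j,k}$ is the tree that has exactly one vertex $x$ of degree $3$ and exactly three leaves, which are at distances $i$, $j$ and $k$ from $x$. The clique-width $\mathrm{cw}(G)$ of a graph $G$ is the minimum number of labels needed to construct $G$ using the operations: create a single vertex with label $i$; take the disjoint union of two labelled graphs; add all edges between vertices labelled $i$ and vertices labelled $j$ ($i\neq j$); rename label $i$ to $j$. A class of graphs has bounded clique-width if there is a constant $c$ such that every graph in the class has clique-width at most $c$. *)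

theory Defs
  imports "Graph_Theory.Digraph_Component" "Graph_Theory.Digraph_Isomorphism"
begin

text \<open>
  A finite simple undirected graph is a \<^const>\<open>pair_graph\<close>: a finite vertex set together with a
  symmetric irreflexive arc relation, an edge being represented by its two opposite arcs.
\<close>

subsection \<open>Operations on graphs, and induced subgraphs\<close>

definition graph_complement :: "'a pair_pre_digraph \<Rightarrow> 'a pair_pre_digraph" where
  "graph_complement G =
    \<lparr> pverts = pverts G,
      parcs = {(u, v). u \<in> pverts G \<and> v \<in> pverts G \<and> u \<noteq> v \<and> (u, v) \<notin> parcs G} \<rparr>"

definition disjoint_union ::
    "'a pair_pre_digraph \<Rightarrow> 'b pair_pre_digraph \<Rightarrow> ('a + 'b) pair_pre_digraph" where
  "disjoint_union G H =
    \<lparr> pverts = pverts G <+> pverts H,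
      parcs = map_prod Inl Inl ` parcs G \<union> map_prod Inr Inr ` parcs H \<rparr>"

definition induced_free :: "'b pair_pre_digraph \<Rightarrow> 'a pair_pre_digraph \<Rightarrow> bool" where
  "induced_free H G \<longleftrightarrow>
    \<not> (\<exists>K. induced_subgraph K (with_proj G) \<and> digraph_iso K (with_proj H))"


subsection \<open>Paths and the trees \<open>S\<^sub>i\<^sub>,\<^sub>j\<^sub>,\<^sub>k\<close>\<close>

definition path_graph :: "nat \<Rightarrow> nat pair_pre_digraph" where
  "path_graph r =
    \<lparr> pverts = {..<r},
      parcs = {(u, v). u < r \<and> v < r \<and> (v = Suc u \<or> u = Suc v)} \<rparr>"

text \<open>
  The vertex of degree 3 is \<open>(0, 0)\<close>; the vertex at distance \<open>d \<ge> 1\<close> from it on the leg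
  \<open>l \<in> {1, 2, 3}\<close> is \<open>(l, d)\<close>, and the legs have lengths \<open>i\<close>, \<open>j\<close> and \<open>k\<close>.
\<close>

definition S_graph :: "nat \<Rightarrow> nat \<Rightarrow> nat \<Rightarrow> (nat \<times> nat) pair_pre_digraph" where
  "S_graph i j k =
    (let V = {(0, 0)} \<union> {1} \<times> {1..i} \<union> {2} \<times> {1..j} \<union> {3} \<times> {1..k};
         E = {((0, 0), (l, 1)) | l. True} \<union> {((l, d), (l, Suc d)) | l d. 1 \<le> d}
     in \<lparr> pverts = V, parcs = (E \<union> E\<inverse>) \<inter> V \<times> V \<rparr>)"


subsection \<open>Clique-width\<close>

text \<open>
  In \<open>Join i j s\<close> all edges between label \<open>i\<close> and label \<open>j\<close> are added; \<open>Relabel i j s\<close> renames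
  label \<open>i\<close> to \<open>j\<close>. The set functions \<open>cw_verts\<close> and \<open>cw_labels\<close> collect the created vertices and
  all labels mentioned in an expression.
\<close>

datatype (cw_verts: 'a, cw_labels: 'l) cw_expr =
    Vertex 'l 'a
  | Disj "('a, 'l) cw_expr" "('a, 'l) cw_expr"
  | Join 'l 'l "('a, 'l) cw_expr"
  | Relabel 'l 'l "('a, 'l) cw_expr"

primrec cw_label :: "('a, 'l) cw_expr \<Rightarrow> 'a \<Rightarrow> 'l" where
  "cw_label (Vertex i u) v = i"
| "cw_label (Disj s t) v = (if v \<in> cw_verts s then cw_label s v else cw_label t v)"
| "cw_label (Join i j s) v = cw_label s v"
| "cw_label (Relabel i j s) v = (if cw_label s v = i then j else cw_label s v)"

primrec cw_arcs :: "('a, 'l) cw_expr \<Rightarrow> 'a rel" where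
  "cw_arcs (Vertex i u) = {}"
| "cw_arcs (Disj s t) = cw_arcs s \<union> cw_arcs t"
| "cw_arcs (Join i j s) =
    (let I = {v \<in> cw_verts s. cw_label s v = i}; J = {v \<in> cw_verts s. cw_label s v = j}
     in cw_arcs s \<union> I \<times> J \<union> J \<times> I)"
| "cw_arcs (Relabel i j s) = cw_arcs s"

primrec cw_valid :: "('a, 'l) cw_expr \<Rightarrow> bool" where
  "cw_valid (Vertex i u) \<longleftrightarrow> True"
| "cw_valid (Disj s t) \<longleftrightarrow> cw_valid s \<and> cw_valid t \<and> cw_verts s \<inter> cw_verts t = {}"
| "cw_valid (Join i j s) \<longleftrightarrow> cw_valid s \<and> i \<noteq> j"
| "cw_valid (Relabel i j s) \<longleftrightarrow> cw_valid s"

definition cw_graph :: "('a, 'l) cw_expr \<Rightarrow> 'a pair_pre_digraph" where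
  "cw_graph s = \<lparr> pverts = cw_verts s, parcs = cw_arcs s \<rparr>"

text \<open>
  No expression builds the graph without vertices; its clique-width is set to 0. Every other graph
  has an expression, see \<open>ex_cw_expr\<close> below.
\<close>

definition clique_width :: "'a pair_pre_digraph \<Rightarrow> nat" where
  "clique_width G =
    (if pverts G = {} then 0
     else LEAST k. \<exists>s :: ('a, nat) cw_expr. cw_valid s \<and> cw_graph s = G \<and> card (cw_labels s) = k)"

definition bounded_clique_width :: "'a pair_pre_digraph set \<Rightarrow> bool" where
  "bounded_clique_width \<G> \<longleftrightarrow> (\<exists>c. \<forall>G\<in>\<G>. clique_width G \<le> c)"

lemma ex_cw_expr_edgeless:
  assumes "finite V" "V \<noteq> {}"
  shows "\<exists>s :: ('a, 'l) cw_expr. cw_valid s \<and> cw_verts s = V \<and> cw_arcs s = {} \<and>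
    (\<forall>v\<in>V. cw_label s v = f v)"
  using assms
proof (induction V rule: finite_ne_induct)
  case (singleton x)
  then show ?case by (intro exI[of _ "Vertex (f x) x"]) auto
next
  case (insert x F)
  then obtain s :: "('a, 'l) cw_expr" where "cw_valid s" "cw_verts s = F" "cw_arcs s = {}"
    "\<forall>v\<in>F. cw_label s v = f v" by blast
  with insert.hyps show ?case by (intro exI[of _ "Disj (Vertex (f x) x) s"]) auto
qed

lemma ex_cw_expr:
  assumes "pair_graph G" "pverts G \<noteq> {}"
  shows "\<exists>s :: ('a, nat) cw_expr. cw_valid s \<and> cw_graph s = G"
proof -
  interpret pair_graph G by fact
  obtain f :: "'a \<Rightarrow> nat" where f: "inj_on f (pverts G)"
    using finite_imp_inj_to_nat_seg[OF pair_finite_verts] by blast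
  have symG: "(v, u) \<in> parcs G" if "(u, v) \<in> parcs G" for u v
    using that pair_sym_arcs unfolding symmetric_def by (auto dest: symD)
  have "\<exists>s :: ('a, nat) cw_expr. cw_valid s \<and> cw_verts s = pverts G \<and> cw_arcs s = A \<union> A\<inverse> \<and>
      (\<forall>v\<in>pverts G. cw_label s v = f v)" if "A \<subseteq> parcs G" for A
    using finite_subset[OF that pair_finite_arcs] that
  proof (induction A rule: finite_induct)
    case empty
    then show ?case using ex_cw_expr_edgeless[OF pair_finite_verts assms(2), of f] by simp
  next
    case (insert e A)
    then obtain s :: "('a, nat) cw_expr" where s: "cw_valid s" "cw_verts s = pverts G"
      "cw_arcs s = A \<union> A\<inverse>" "\<forall>v\<in>pverts G. cw_label s v = f v" by blast
    obtain x y where e: "e = (x, y)" by force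
    have xy: "x \<in> pverts G" "y \<in> pverts G" "x \<noteq> y"
      using insert.prems e pair_no_loops[of e] by (auto dest: in_arcsD1 in_arcsD2)
    have "{v \<in> pverts G. cw_label s v = f x} = {x}" "{v \<in> pverts G. cw_label s v = f y} = {y}"
      using s(4) f xy by (auto dest: inj_onD)
    moreover have "f x \<noteq> f y" using f xy by (auto dest: inj_onD)
    ultimately show ?case using s e by (intro exI[of _ "Join (f x) (f y) s"]) auto
  qed
  from this[OF subset_refl] obtain s :: "('a, nat) cw_expr" where
    s: "cw_valid s" "cw_verts s = pverts G" "cw_arcs s = parcs G \<union> (parcs G)\<inverse>" by blast
  moreover have "parcs G \<union> (parcs G)\<inverse> = parcs G" using symG by auto
  ultimately show ?thesis by (intro exI[of _ s]) (simp add: cw_graph_def)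
qed

end

theory Submission
  imports Defs
begin

text \<open>
  Clique-width is controlled by layouts: binary trees over the vertices in which every node induces
  boundedly many distinct neighbourhoods outside of its vertex set. The existence of such layouts is
  insensitive to adding pendant vertices and twins, to disjoint unions, and to flipping the
  adjacency between boundedly many vertex classes.

  A connected paw-free graph is complete multipartite or triangle-free, so let the graph be
  triangle-free. If it contains an induced chair \<open>S\<^sub>1\<^sub>,\<^sub>1\<^sub>,\<^sub>2\<close>, then the chair dominates it; with all
  degrees at most 6 the graph is then bounded. Without a chair, every component has maximum degree
  at most 2 or is almost complete bipartite.

  It remains to treat a vertex \<open>v\<close> of degree at least 7. Let \<open>A\<close> be its neighbourhood and \<open>B\<close> the set
  of its non-neighbours, which induces a chair-free graph. Chairs centred at \<open>v\<close> show that
  non-adjacent vertices of \<open>B\<close> have equal neighbourhoods in \<open>A\<close> or at most one common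
  non-neighbour in \<open>A\<close>. Hence the vertices of \<open>B\<close> that see at most half of \<open>A\<close> have at most five
  neighbourhoods in \<open>A\<close>, while for the set \<open>H\<close> of the others the non-edges between \<open>A\<close> and \<open>H\<close> form,
  up to twins, stars, paths and cycles. After flipping boundedly many classes, the graph is the
  disjoint union of a chair-free graph on part of \<open>B\<close> and of a graph that reduces to maximum degree
  2 by removing pendant vertices and twins.
\<close>

section \<open>Layouts\<close>

definition ext_nbhd :: "'a set \<Rightarrow> ('a \<Rightarrow> 'a \<Rightarrow> bool) \<Rightarrow> 'a set \<Rightarrow> 'a \<Rightarrow> 'a set" where
  "ext_nbhd V E X x = {w \<in> V - X. E x w}"

definition ext_nbhds :: "'a set \<Rightarrow> ('a \<Rightarrow> 'a \<Rightarrow> bool) \<Rightarrow> 'a set \<Rightarrow> 'a set set" where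
  "ext_nbhds V E X = ext_nbhd V E X ` X - {{}}"

text \<open>A layout is encoded by the vertex sets of its subtrees. Counting the empty set in
  \<open>ext_nbhds\<close> as well would turn the least admissible \<open>k\<close> into the
  module-width. A leaf has at most one non-empty outer neighbourhood, hence \<open>1 \<le> k\<close>
  there.\<close>

inductive layout :: "'a set \<Rightarrow> ('a \<Rightarrow> 'a \<Rightarrow> bool) \<Rightarrow> nat \<Rightarrow> 'a set \<Rightarrow> bool" for V E k where
  layout_single: "v \<in> V \<Longrightarrow> 1 \<le> k \<Longrightarrow> layout V E k {v}"
| layout_join: "layout V E k X \<Longrightarrow> layout V E k Y \<Longrightarrow> X \<inter> Y = {} \<Longrightarrow>
    card (ext_nbhds V E (X \<union> Y)) \<le> k \<Longrightarrow> layout V E k (X \<union> Y)"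

definition width_le :: "'a set \<Rightarrow> ('a \<Rightarrow> 'a \<Rightarrow> bool) \<Rightarrow> nat \<Rightarrow> bool" where
  "width_le V E k \<longleftrightarrow> V = {} \<or> layout V E k V"

lemma layout_subset: "layout V E k X \<Longrightarrow> X \<subseteq> V \<and> X \<noteq> {} \<and> finite X"
  by (induction rule: layout.induct) auto

lemma finite_ext_nbhds: "finite X \<Longrightarrow> finite (ext_nbhds V E X)"
  by (simp add: ext_nbhds_def)

lemma layout_mono: "layout V E k X \<Longrightarrow> k \<le> l \<Longrightarrow> layout V E l X"
  by (induction rule: layout.induct) (auto intro: layout.intros)

lemma width_le_mono: "width_le V E k \<Longrightarrow> k \<le> l \<Longrightarrow> width_le V E l"
  by (auto simp: width_le_def intro: layout_mono)

lemma width_le_empty [simp]: "width_le {} E k"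
  by (simp add: width_le_def)

lemma width_le_singleton: "1 \<le> k \<Longrightarrow> width_le {v} E k"
  by (auto simp: width_le_def intro: layout_single)

lemma width_le_cong:
  assumes "width_le V E k" and "\<And>u w. u \<in> V \<Longrightarrow> w \<in> V \<Longrightarrow> E u w = E' u w"
  shows "width_le V E' k"
proof -
  have "layout V E' k X" if "layout V E k X" for X
    using that
  proof (induction rule: layout.induct)
    case (layout_join X Y)
    have "X \<union> Y \<subseteq> V" using layout_join.hyps layout_subset by blast
    then have "ext_nbhd V E' (X \<union> Y) x = ext_nbhd V E (X \<union> Y) x" if "x \<in> X \<union> Y" for x
      using that assms(2) by (auto simp: ext_nbhd_def)
    then have "ext_nbhds V E' (X \<union> Y) = ext_nbhds V E (X \<union> Y)"
      by (simp add: ext_nbhds_def cong: image_cong_simp)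
    then show ?case using layout_join by (metis layout.layout_join)
  qed (auto intro: layout_single)
  then show ?thesis using assms(1) by (auto simp: width_le_def)
qed

text \<open>Without edges between the parts, the outer neighbourhoods inside one part do not change
  when the other part is added. The new root sees nothing outside, so joining the two layouts costs
  nothing.\<close>

lemma width_le_disjoint_union:
  assumes "width_le U E k" "width_le W E k" "U \<inter> W = {}"
    and no_edge: "\<And>u w. u \<in> U \<Longrightarrow> w \<in> W \<Longrightarrow> \<not> E u w \<and> \<not> E w u"
  shows "width_le (U \<union> W) E k"
proof -
  have extend: "layout (S \<union> T) E k X"
    if "layout S E k X" and no: "\<And>u w. u \<in> S \<Longrightarrow> w \<in> T \<Longrightarrow> \<not> E u w" and "S \<inter> T = {}" for S T X
    using that(1)
  proof (induction rule: layout.induct)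
    case (layout_join X Y)
    have "X \<union> Y \<subseteq> S" using layout_join.hyps layout_subset by blast
    then have "ext_nbhd (S \<union> T) E (X \<union> Y) x = ext_nbhd S E (X \<union> Y) x" if "x \<in> X \<union> Y" for x
      using that no by (auto simp: ext_nbhd_def)
    then have "ext_nbhds (S \<union> T) E (X \<union> Y) = ext_nbhds S E (X \<union> Y)"
      by (simp add: ext_nbhds_def cong: image_cong_simp)
    then show ?case using layout_join by (metis layout.layout_join)
  qed (auto intro: layout_single)
  show ?thesis
  proof (cases "U = {} \<or> W = {}")
    case False
    then have "layout (U \<union> W) E k U" "layout (W \<union> U) E k W"
      using assms by (auto simp: width_le_def intro!: extend)
    moreover have "ext_nbhds (U \<union> W) E (U \<union> W) = {}"
      by (auto simp: ext_nbhds_def ext_nbhd_def)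
    ultimately show ?thesis
      using assms(3) by (simp add: width_le_def layout_join Un_commute)
  qed (use assms in auto)
qed

text \<open>The attached vertex \<open>t\<close> is placed next to \<open>h\<close> in the layout. For a pendant vertex this keeps the
  width because the empty neighbourhood is not counted.\<close>

definition attachable :: "'a set \<Rightarrow> ('a \<Rightarrow> 'a \<Rightarrow> bool) \<Rightarrow> 'a \<Rightarrow> bool" where
  "attachable V E t \<longleftrightarrow> t \<in> V \<and> (\<exists>h\<in>V - {t}.
     (\<forall>w\<in>V - {t, h}. \<not> E t w) \<or> (\<forall>w\<in>V - {t, h}. E t w \<longleftrightarrow> E h w))"

lemma width_le_attach:
  assumes wd: "width_le (V - {t}) E k" and att: "attachable V E t" and sym: "symp E"
  shows "width_le V E k"
proof -
  let ?W = "V - {t}"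
  obtain h where h: "h \<in> ?W" "t \<in> V"
    and alt: "(\<forall>w\<in>V - {t, h}. \<not> E t w) \<or> (\<forall>w\<in>V - {t, h}. E t w \<longleftrightarrow> E h w)"
    using att by (auto simp: attachable_def)
  \<comment> \<open>\<open>\<phi>\<close> adds \<open>t\<close> to every subtree that contains
    \<open>h\<close>. There \<open>t\<close> contributes the outer neighbourhood of \<open>h\<close>
    or the empty one; for the other subtrees \<open>t\<close> is an outer vertex that is either
    unseen or seen exactly together with \<open>h\<close>.\<close>
  define \<phi> where "\<phi> X = (if h \<in> X then insert t X else X)" for X
  have card_le: "card (ext_nbhds V E (\<phi> Z)) \<le> card (ext_nbhds ?W E Z)" if Z: "Z \<subseteq> ?W" "finite Z" for Z
  proof (cases "h \<in> Z")
    case True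
    have eq: "ext_nbhd V E (insert t Z) x = ext_nbhd ?W E Z x" for x
      by (auto simp: ext_nbhd_def)
    have "ext_nbhd ?W E Z t = {} \<or> ext_nbhd ?W E Z t = ext_nbhd ?W E Z h"
      using alt True by (auto simp: ext_nbhd_def)
    then have "ext_nbhds V E (insert t Z) \<subseteq> ext_nbhds ?W E Z"
      using True by (auto simp: ext_nbhds_def eq)
    then show ?thesis using True Z(2) by (simp add: \<phi>_def card_mono finite_ext_nbhds)
  next
    case False
    show ?thesis
    proof (cases "\<forall>w\<in>V - {t, h}. \<not> E t w")
      case True
      have "ext_nbhd V E Z x = ext_nbhd ?W E Z x" if "x \<in> Z" for x
        using that Z True False sym by (auto simp: ext_nbhd_def dest: sympD)
      then have "ext_nbhds V E Z = ext_nbhds ?W E Z"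
        by (simp add: ext_nbhds_def cong: image_cong_simp)
      then show ?thesis using False by (simp add: \<phi>_def)
    next
      case twin: False
      have E: "E x t = E x h" if "x \<in> Z" for x
      proof -
        have "x \<in> V - {t, h}" using that Z False by auto
        then show ?thesis using twin alt sym by (metis sympD)
      qed
      let ?g = "\<lambda>T. if h \<in> T then insert t T else T"
      have "ext_nbhd V E Z x = ?g (ext_nbhd ?W E Z x)" if "x \<in> Z" for x
        using that Z False h E[OF that] by (auto simp: ext_nbhd_def)
      then have "ext_nbhds V E Z \<subseteq> ?g ` ext_nbhds ?W E Z"
        by (auto simp: ext_nbhds_def image_iff)
      then have "card (ext_nbhds V E Z) \<le> card (ext_nbhds ?W E Z)"
        by (rule surj_card_le[OF finite_ext_nbhds[OF Z(2)]])
      then show ?thesis using False by (simp add: \<phi>_def)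
    qed
  qed
  have "layout V E k (\<phi> X)" if "layout ?W E k X" for X
    using that
  proof (induction rule: layout.induct)
    case (layout_single v)
    show ?case
    proof (cases "v = h")
      case True
      have "ext_nbhds V E ({h} \<union> {t}) \<subseteq> {ext_nbhd V E {h, t} h}"
        using alt by (auto simp: ext_nbhds_def ext_nbhd_def)
      then have "card (ext_nbhds V E ({h} \<union> {t})) \<le> 1"
        by (metis card.empty card_insert_disjoint card_mono empty_iff finite.intros One_nat_def)
      then have "layout V E k ({h} \<union> {t})"
        using layout_single h by (intro layout_join layout.layout_single) auto
      then show ?thesis using True by (simp add: \<phi>_def insert_commute)
    next
      case False
      then show ?thesis using layout_single by (auto simp: \<phi>_def intro: layout.layout_single)
    qed
  next
    case (layout_join X Y)
    have sub: "X \<subseteq> ?W" "Y \<subseteq> ?W" "finite X" "finite Y"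
      using layout_join.hyps layout_subset by blast+
    have "\<phi> (X \<union> Y) = \<phi> X \<union> \<phi> Y" "\<phi> X \<inter> \<phi> Y = {}"
      using sub layout_join.hyps by (auto simp: \<phi>_def)
    moreover have "card (ext_nbhds V E (\<phi> (X \<union> Y))) \<le> k"
      using card_le[of "X \<union> Y"] sub layout_join.hyps by simp
    ultimately show ?case using layout_join.IH by (simp add: layout.layout_join)
  qed
  moreover have "\<phi> ?W = V" "?W \<noteq> {}" using h by (auto simp: \<phi>_def)
  ultimately show ?thesis using wd unfolding width_le_def by metis
qed

lemma card_image_le_of_factor:
  assumes "finite X" and "\<And>x y. x \<in> X \<Longrightarrow> y \<in> X \<Longrightarrow> g x = g y \<Longrightarrow> f x = f y"
  shows "card (f ` X) \<le> card (g ` X)"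
proof -
  have "f ` X \<subseteq> (\<lambda>z. f (inv_into X g z)) ` (g ` X)"
  proof
    fix y assume "y \<in> f ` X"
    then obtain x where x: "x \<in> X" "y = f x" by blast
    then have "f (inv_into X g (g x)) = f x"
      by (metis assms(2) f_inv_into_f image_eqI inv_into_into)
    then show "y \<in> (\<lambda>z. f (inv_into X g z)) ` (g ` X)" using x by force
  qed
  then show ?thesis by (rule surj_card_le[OF finite_imageI[OF assms(1)]])
qed

text \<open>The class and the outer neighbourhood under \<open>E'\<close> determine the outer
  neighbourhood under \<open>E\<close>; the \<open>+ 1\<close> accounts for the empty neighbourhood,
  which the width under \<open>E'\<close> does not count. The flip may depend on \<open>w\<close> in
  any way: only the classes on the side of \<open>x\<close> are counted.\<close>

lemma width_le_flip:
  assumes wd: "width_le V E' k" and fin: "finite (c ` V)" "card (c ` V) \<le> m"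
    and flip: "\<And>x y w. x \<in> V \<Longrightarrow> y \<in> V \<Longrightarrow> w \<in> V \<Longrightarrow> c x = c y \<Longrightarrow> w \<noteq> x \<Longrightarrow> w \<noteq> y \<Longrightarrow>
      (E x w \<longleftrightarrow> E' x w) \<longleftrightarrow> (E y w \<longleftrightarrow> E' y w)"
  shows "width_le V E (m * (k + 1))"
proof -
  have "layout V E (m * (k + 1)) X" if "layout V E' k X" for X
    using that
  proof (induction rule: layout.induct)
    case (layout_single v)
    have "card (c ` V) \<noteq> 0" using layout_single fin by auto
    then have "1 \<le> m * (k + 1)" using fin(2) by (cases m) auto
    then show ?case using layout_single by (simp add: layout.layout_single)
  next
    case (layout_join X Y)
    let ?Z = "X \<union> Y"
    have Z: "?Z \<subseteq> V" "finite ?Z" using layout_join.hyps layout_subset by blast+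
    have "card (ext_nbhds V E ?Z) \<le> card (ext_nbhd V E ?Z ` ?Z)"
      using Z(2) by (auto simp: ext_nbhds_def intro!: card_mono)
    also have "\<dots> \<le> card ((\<lambda>x. (c x, ext_nbhd V E' ?Z x)) ` ?Z)"
    proof (rule card_image_le_of_factor)
      fix x y assume xy: "x \<in> ?Z" "y \<in> ?Z"
        and eq: "(c x, ext_nbhd V E' ?Z x) = (c y, ext_nbhd V E' ?Z y)"
      have "E x w = E y w" if "w \<in> V - ?Z" for w
      proof -
        have "E' x w = E' y w" using that eq unfolding ext_nbhd_def by blast
        moreover have "(E x w \<longleftrightarrow> E' x w) \<longleftrightarrow> (E y w \<longleftrightarrow> E' y w)"
          using that eq xy Z by (intro flip) auto
        ultimately show ?thesis by blast
      qed
      then show "ext_nbhd V E ?Z x = ext_nbhd V E ?Z y" by (auto simp: ext_nbhd_def)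
    qed (use Z in simp)
    also have "\<dots> \<le> card (c ` V \<times> insert {} (ext_nbhds V E' ?Z))"
      using Z fin by (intro card_mono) (auto simp: ext_nbhds_def)
    also have "\<dots> = card (c ` V) * (card (ext_nbhds V E' ?Z) + 1)"
    proof -
      have "{} \<notin> ext_nbhds V E' ?Z" by (simp add: ext_nbhds_def)
      then show ?thesis using finite_ext_nbhds[OF Z(2)] by (simp add: card_cartesian_product)
    qed
    also have "\<dots> \<le> m * (k + 1)"
      using fin(2) layout_join.hyps by (intro mult_le_mono) auto
    finally show ?case using layout_join by (intro layout.layout_join) auto
  qed
  then show ?thesis using wd by (auto simp: width_le_def)
qed

text \<open>When vertices are added one at a time, a subtree has no more outer neighbourhoods than
  vertices.\<close>

lemma width_le_card:
  assumes "finite V" "card V \<le> n"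
  shows "width_le V E n"
proof -
  have "layout V E n X" if "finite X" "X \<noteq> {}" "X \<subseteq> V" for X
    using that
  proof (induction X rule: finite_ne_induct)
    case (singleton x)
    then have "card V \<noteq> 0" using assms by auto
    then have "1 \<le> n" using assms by linarith
    then show ?case using singleton by (auto intro: layout_single)
  next
    case (insert x F)
    have "card (ext_nbhds V E (insert x F)) \<le> card (ext_nbhd V E (insert x F) ` insert x F)"
      using insert.hyps by (auto simp: ext_nbhds_def intro!: card_mono)
    also have "\<dots> \<le> card (insert x F)" using insert.hyps by (intro card_image_le) auto
    also have "\<dots> \<le> card V" using insert.prems assms by (intro card_mono)
    finally have c: "card (ext_nbhds V E ({x} \<union> F)) \<le> n" using assms by simp
    have "card V \<noteq> 0" using insert.prems assms by auto
    then have "1 \<le> n" using assms by linarith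
    then have "layout V E n ({x} \<union> F)"
      using insert c by (intro layout_join) (auto intro: layout_single)
    then show ?case by simp
  qed
  then show ?thesis using assms by (auto simp: width_le_def)
qed

section \<open>Components, reducible graphs and graphs of small maximum degree\<close>

definition conn_graph :: "'a set \<Rightarrow> ('a \<Rightarrow> 'a \<Rightarrow> bool) \<Rightarrow> bool" where
  "conn_graph V E \<longleftrightarrow>
    (\<forall>U. U \<subseteq> V \<longrightarrow> U \<noteq> {} \<longrightarrow> (\<forall>u\<in>U. \<forall>w\<in>V. E u w \<longrightarrow> w \<in> U) \<longrightarrow> U = V)"

text \<open>Connectedness is used without walks: a property that passes to neighbours and holds
  somewhere holds everywhere.\<close>

lemma conn_graphD:
  assumes "conn_graph V E" "U \<subseteq> V" "u \<in> U" "\<And>u w. u \<in> U \<Longrightarrow> w \<in> V \<Longrightarrow> E u w \<Longrightarrow> w \<in> U"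
  shows "U = V"
  using assms unfolding conn_graph_def by (metis empty_iff)

lemma width_le_components:
  assumes "finite V" "symp E"
    and "\<And>U. U \<subseteq> V \<Longrightarrow> U \<noteq> {} \<Longrightarrow> conn_graph U E \<Longrightarrow> width_le U E k"
  shows "width_le V E k"
  using assms(1,3)
proof (induction V rule: finite_psubset_induct)
  case (psubset V)
  show ?case
  proof (cases "V = {} \<or> conn_graph V E")
    case True
    then show ?thesis using psubset.prems[of V] by (cases "V = {}") auto
  next
    case False
    then obtain U where U: "U \<subseteq> V" "U \<noteq> {}" "U \<noteq> V" "\<forall>u\<in>U. \<forall>w\<in>V. E u w \<longrightarrow> w \<in> U"
      unfolding conn_graph_def by blast
    have "width_le W E k" if "W \<subset> V" for W
    proof (rule psubset.IH[OF that])
      fix S assume "S \<subseteq> W" "S \<noteq> {}" "conn_graph S E"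
      then show "width_le S E k" using that psubset.prems[of S] by blast
    qed
    then have "width_le U E k" "width_le (V - U) E k" using U by blast+
    moreover have "\<not> E u w \<and> \<not> E w u" if "u \<in> U" "w \<in> V - U" for u w
      using that U assms(2) by (meson DiffD1 DiffD2 sympD)
    ultimately have "width_le (U \<union> (V - U)) E k"
      by (intro width_le_disjoint_union) auto
    then show ?thesis using U by (simp add: Un_absorb1)
  qed
qed

text \<open>Attachable vertices are removed one by one until a set of width at most \<open>k\<close>
  remains. The hypothesis covers all induced subgraphs because the order of removal is not known in
  advance.\<close>

lemma width_le_reducible:
  assumes "finite V" "symp E" "1 \<le> k"
    and "\<And>U. U \<subseteq> V \<Longrightarrow> U \<noteq> {} \<Longrightarrow> (\<exists>t. attachable U E t) \<or> width_le U E k"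
  shows "width_le V E k"
  using assms(1,4)
proof (induction V rule: finite_psubset_induct)
  case (psubset V)
  show ?case
  proof (cases "\<exists>t. attachable V E t")
    case True
    then obtain t where t: "attachable V E t" ..
    then have "t \<in> V" by (simp add: attachable_def)
    have "width_le (V - {t}) E k"
    proof (rule psubset.IH)
      show "V - {t} \<subset> V" using \<open>t \<in> V\<close> by blast
      fix U assume "U \<subseteq> V - {t}" "U \<noteq> {}"
      then show "(\<exists>s. attachable U E s) \<or> width_le U E k" using psubset.prems[of U] by blast
    qed
    then show ?thesis using t assms(2) by (rule width_le_attach)
  next
    case False
    then show ?thesis using psubset.prems[of V] by (cases "V = {}") auto
  qed
qed

text \<open>The partner \<open>h\<close> is the only neighbour of \<open>t\<close>, or an arbitrary
  other vertex if no other vertex is adjacent to \<open>t\<close>.\<close>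

lemma attachable_degree_le_1:
  assumes "t \<in> U" "finite U" "card {w \<in> U. E t w} \<le> 1" "U \<noteq> {t}"
  shows "attachable U E t"
proof -
  have one: "w = w'" if "w \<in> U" "w' \<in> U" "E t w" "E t w'" for w w'
    using card_le_Suc0_iff_eq[of "{w \<in> U. E t w}"] assms that by auto
  obtain h where "h \<in> U - {t}" "\<forall>w\<in>U - {t}. E t w \<longrightarrow> w = h"
  proof (cases "\<exists>h\<in>U - {t}. E t h")
    case True
    then show ?thesis using that one by blast
  next
    case False
    then show ?thesis using that assms(1,4) by blast
  qed
  then show ?thesis using assms(1) by (auto simp: attachable_def)
qed

text \<open>Once the edges at one vertex \<open>v\<close> of a component are deleted, no non-empty
  set has all degrees equal to 2 any more, so the component is built by attaching vertices of degree
  at most 1. A flip restores the edges at \<open>v\<close>.\<close>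

lemma width_le_degree_le_2:
  assumes fin: "finite V" and sym: "symp E"
    and deg: "\<And>u. u \<in> V \<Longrightarrow> card {w \<in> V. E u w} \<le> 2"
  shows "width_le V E 8"
proof (rule width_le_components[OF fin sym])
  fix U assume U: "U \<subseteq> V" "U \<noteq> {}" "conn_graph U E"
  then obtain v where v: "v \<in> U" by blast
  have finU: "finite U" using U fin finite_subset by blast
  define E' where "E' u w \<longleftrightarrow> E u w \<and> u \<noteq> v \<and> w \<noteq> v" for u w
  have symE': "symp E'" using sym by (auto simp: E'_def symp_def)
  have "width_le U E' 1"
  proof (rule width_le_reducible[OF finU symE'])
    fix S assume S: "S \<subseteq> U" "S \<noteq> {}"
    have finS: "finite S" using S finU finite_subset by blast
    show "(\<exists>t. attachable S E' t) \<or> width_le S E' 1"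
    proof (cases "\<exists>t\<in>S. card {w \<in> S. E' t w} \<le> 1")
      case True
      then obtain t where t: "t \<in> S" "card {w \<in> S. E' t w} \<le> 1" by blast
      show ?thesis
      proof (cases "S = {t}")
        case False
        then show ?thesis using attachable_degree_le_1[of t S E'] t finS by blast
      qed (simp add: width_le_singleton)
    next
      case False
      then have big: "2 \<le> card {w \<in> S. E' t w}" if "t \<in> S" for t
        using that by force
      have "v \<notin> S" using big[of v] by (auto simp: E'_def)
      \<comment> \<open>All degrees within \<open>S\<close> already reach the maximum 2, so no edge
        leaves \<open>S\<close>. By connectedness \<open>S\<close> would contain \<open>v\<close>,
        which \<open>E'\<close> isolates.\<close>
      have "S = U"
      proof (rule conn_graphD[OF U(3) S(1)])
        show "(SOME x. x \<in> S) \<in> S" using S(2) by (simp add: some_in_eq)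
        fix u w assume uw: "u \<in> S" "w \<in> U" "E u w"
        have sub: "{w \<in> S. E' u w} \<subseteq> {w \<in> V. E u w}"
          using S U by (auto simp: E'_def)
        moreover have "card {w \<in> V. E u w} \<le> card {w \<in> S. E' u w}"
          using big[OF uw(1)] deg[of u] uw S U by fastforce
        ultimately have "{w \<in> S. E' u w} = {w \<in> V. E u w}"
          using fin by (intro card_seteq) auto
        then show "w \<in> S" using uw U by blast
      qed
      then show ?thesis using v \<open>v \<notin> S\<close> by simp
    qed
  qed simp
  \<comment> \<open>Four classes suffice: being \<open>v\<close> or not, and being adjacent to
    \<open>v\<close> or not. The bound is then 4 * (1 + 1) = 8.\<close>
  moreover have "card ((\<lambda>u. (u = v, E u v)) ` U) \<le> card (({True, False}) \<times> {True, False})"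
    by (intro card_mono) auto
  then have "card ((\<lambda>u. (u = v, E u v)) ` U) \<le> 4" by (simp add: card_cartesian_product)
  ultimately have "width_le U E (4 * (1 + 1))"
    by (rule_tac width_le_flip[where c = "\<lambda>u. (u = v, E u v)" and E' = E']) (use finU in \<open>auto simp: E'_def\<close>)
  then show "width_le U E 8" by simp
qed

lemma width_le_degree_le_1:
  assumes "finite V" "symp E" "\<And>u. u \<in> V \<Longrightarrow> card {w \<in> V. E u w} \<le> 1"
  shows "width_le V E 1"
proof (rule width_le_reducible[OF assms(1,2)])
  fix U assume U: "U \<subseteq> V" "U \<noteq> {}"
  then obtain t where t: "t \<in> U" by blast
  have "card {w \<in> U. E t w} \<le> card {w \<in> V. E t w}"
    using U assms(1) by (intro card_mono) auto
  also have "\<dots> \<le> 1" using assms(3) t U by blast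
  finally have deg: "card {w \<in> U. E t w} \<le> 1" .
  show "(\<exists>t. attachable U E t) \<or> width_le U E 1"
  proof (cases "U = {t}")
    case False
    have "finite U" using U assms(1) finite_subset by blast
    then show ?thesis using attachable_degree_le_1[of t U E] t deg False by blast
  qed (simp add: width_le_singleton)
qed simp

lemma ex_three_of_card_ge_3:
  assumes "3 \<le> card S"
  obtains a b c where "a \<in> S" "b \<in> S" "c \<in> S" "a \<noteq> b" "a \<noteq> c" "b \<noteq> c"
proof -
  obtain T where T: "T \<subseteq> S" "card T = 3" using assms obtain_subset_with_card_n by metis
  from T(2) obtain a b c where "T = {a, b, c}" "a \<noteq> b" "a \<noteq> c" "b \<noteq> c"
    unfolding card_3_iff by (elim exE conjE)
  then show ?thesis using T(1) by (intro that[of a b c]) auto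
qed

section \<open>From layouts to clique-width\<close>

text \<open>\<open>Relabel\<close> acts on one label at a time. Since no new label lies in
  \<open>I\<close>, the successive renamings amount to a simultaneous one.\<close>

lemma ex_cw_relabel:
  fixes s :: "('a, 'l) cw_expr"
  assumes "finite I" "g ` I \<inter> I = {}" "cw_valid s"
  shows "\<exists>s' :: ('a, 'l) cw_expr. cw_valid s' \<and> cw_verts s' = cw_verts s \<and> cw_arcs s' = cw_arcs s \<and>
    cw_labels s' \<subseteq> cw_labels s \<union> I \<union> g ` I \<and>
    (\<forall>u. cw_label s' u = (if cw_label s u \<in> I then g (cw_label s u) else cw_label s u))"
  using assms
proof (induction I rule: finite_induct)
  case empty
  then show ?case by (intro exI[of _ s]) auto
next
  case (insert i I)
  then obtain s' :: "('a, 'l) cw_expr" where "cw_valid s'" "cw_verts s' = cw_verts s"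
    "cw_arcs s' = cw_arcs s" "cw_labels s' \<subseteq> cw_labels s \<union> I \<union> g ` I"
    "\<forall>u. cw_label s' u = (if cw_label s u \<in> I then g (cw_label s u) else cw_label s u)"
    by (auto simp: disjoint_iff)
  with insert.hyps insert.prems show ?case
    by (intro exI[of _ "Relabel i (g i) s'"]) (auto simp: disjoint_iff)
qed

lemma ex_cw_joins:
  fixes s :: "('a, 'l) cw_expr"
  assumes "finite R" "\<forall>i j. (i, j) \<in> R \<longrightarrow> i \<noteq> j" "cw_valid s"
  shows "\<exists>s' :: ('a, 'l) cw_expr. cw_valid s' \<and> cw_verts s' = cw_verts s \<and>
    cw_label s' = cw_label s \<and> cw_labels s' \<subseteq> cw_labels s \<union> fst ` R \<union> snd ` R \<and>
    cw_arcs s' = cw_arcs s \<union> {(u, w). u \<in> cw_verts s \<and> w \<in> cw_verts s \<and>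
      ((cw_label s u, cw_label s w) \<in> R \<or> (cw_label s w, cw_label s u) \<in> R)}"
  using assms
proof (induction R rule: finite_induct)
  case empty
  then show ?case by (intro exI[of _ s]) auto
next
  case (insert p R)
  obtain i j where p: "p = (i, j)" by force
  have "\<forall>i j. (i, j) \<in> R \<longrightarrow> i \<noteq> j" using insert.prems(1) by blast
  from insert.IH[OF this insert.prems(2)] obtain s' :: "('a, 'l) cw_expr" where "cw_valid s'" "cw_verts s' = cw_verts s"
    "cw_label s' = cw_label s" "cw_labels s' \<subseteq> cw_labels s \<union> fst ` R \<union> snd ` R"
    "cw_arcs s' = cw_arcs s \<union> {(u, w). u \<in> cw_verts s \<and> w \<in> cw_verts s \<and>
      ((cw_label s u, cw_label s w) \<in> R \<or> (cw_label s w, cw_label s u) \<in> R)}"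
    by (elim exE conjE)
  with insert.prems p show ?case
    by (intro exI[of _ "Join i j s'"]) (auto simp: Let_def)
qed

text \<open>Vertices with equal labels agree outside of \<open>X\<close>, so later edges can be
  added label by label. A subtree uses \<open>k + 1\<close> labels, one more than \<open>k\<close>
  for the empty neighbourhood; at a join, three blocks of this size serve the two subtrees and, as a
  buffer, the new labels.\<close>

lemma ex_cw_expr_layout:
  fixes V :: "'a set"
  assumes "layout V E k X" "symp E" "\<And>u. \<not> E u u"
  shows "\<exists>s :: ('a, nat) cw_expr. cw_valid s \<and> cw_verts s = X \<and>
    cw_arcs s = {(u, w). u \<in> X \<and> w \<in> X \<and> E u w} \<and> cw_labels s \<subseteq> {..<3 * (k + 1)} \<and>
    (\<forall>u\<in>X. cw_label s u < k + 1) \<and>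
    (\<forall>u\<in>X. \<forall>w\<in>X. cw_label s u = cw_label s w \<longrightarrow> ext_nbhd V E X u = ext_nbhd V E X w)"
  using assms(1)
proof (induction rule: layout.induct)
  case (layout_single v)
  then show ?case using assms(3) by (intro exI[of _ "Vertex 0 v"]) auto
next
  case (layout_join X Y)
  define m where "m = k + 1"
  let ?Z = "X \<union> Y"
  have sub: "X \<subseteq> V" "Y \<subseteq> V" "finite X" "finite Y" using layout_join.hyps layout_subset by blast+
  from layout_join.IH(1) obtain s :: "('a, nat) cw_expr" where
    s: "cw_valid s" "cw_verts s = X" "cw_arcs s = {(u, w). u \<in> X \<and> w \<in> X \<and> E u w}"
      "cw_labels s \<subseteq> {..<3 * m}" "\<And>u. u \<in> X \<Longrightarrow> cw_label s u < m"
      "\<And>u w. u \<in> X \<Longrightarrow> w \<in> X \<Longrightarrow> cw_label s u = cw_label s w \<Longrightarrow> ext_nbhd V E X u = ext_nbhd V E X w"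
    unfolding m_def by blast
  from layout_join.IH(2) obtain t :: "('a, nat) cw_expr" where
    t: "cw_valid t" "cw_verts t = Y" "cw_arcs t = {(u, w). u \<in> Y \<and> w \<in> Y \<and> E u w}"
      "cw_labels t \<subseteq> {..<3 * m}" "\<And>u. u \<in> Y \<Longrightarrow> cw_label t u < m"
      "\<And>u w. u \<in> Y \<Longrightarrow> w \<in> Y \<Longrightarrow> cw_label t u = cw_label t w \<Longrightarrow> ext_nbhd V E Y u = ext_nbhd V E Y w"
    unfolding m_def by blast
  have "(\<lambda>i. i + m) ` {..<m} \<inter> {..<m} = {}" by auto
  from ex_cw_relabel[OF _ this t(1)] obtain t' :: "('a, nat) cw_expr" where
    t': "cw_valid t'" "cw_verts t' = Y" "cw_arcs t' = cw_arcs t"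
      "cw_labels t' \<subseteq> cw_labels t \<union> {..<m} \<union> (\<lambda>i. i + m) ` {..<m}"
      "\<And>u. cw_label t' u = (if cw_label t u \<in> {..<m} then cw_label t u + m else cw_label t u)"
    using t(2) by auto
  define d where "d = Disj s t'"
  have d: "cw_valid d" "cw_verts d = ?Z" "cw_labels d \<subseteq> {..<3 * m}"
    using s t t' layout_join.hyps by (auto simp: d_def)
  have dX: "cw_label d u = cw_label s u" if "u \<in> X" for u using that s by (simp add: d_def)
  have dY: "cw_label d u = cw_label t u + m" if "u \<in> Y" for u
    using that s t(5)[OF that] t' layout_join.hyps by (auto simp: d_def)
  have dsame: "(u \<in> X \<and> w \<in> X \<and> cw_label s u = cw_label s w) \<or> (u \<in> Y \<and> w \<in> Y \<and> cw_label t u = cw_label t w)"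
    if "u \<in> ?Z" "w \<in> ?Z" "cw_label d u = cw_label d w" for u w
    using that dX dY s(5) t(5) by (metis UnE add_right_cancel not_add_less2)
  define R where "R = {(i, j). \<exists>u\<in>X. \<exists>w\<in>Y. E u w \<and> i = cw_label d u \<and> j = cw_label d w}"
  have R_sub: "R \<subseteq> {..<m} \<times> {m..<2 * m}"
    using s(5) t(5) dX dY by (fastforce simp: R_def)
  then have R: "finite R" "\<forall>i j. (i, j) \<in> R \<longrightarrow> i \<noteq> j"
    using finite_subset by fastforce+
  \<comment> \<open>Adjacency between \<open>X\<close> and \<open>Y\<close> depends on the labels
    only: \<open>u'\<close> is exchanged for \<open>u\<close> and \<open>w'\<close> for
    \<open>w\<close>, each time because the outer neighbourhoods are equal. Hence the joins create
    no wrong edge.\<close>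
  have R_iff: "(cw_label d u, cw_label d w) \<in> R \<longleftrightarrow> u \<in> X \<and> w \<in> Y \<and> E u w" if "u \<in> ?Z" "w \<in> ?Z" for u w
  proof
    assume "(cw_label d u, cw_label d w) \<in> R"
    then obtain u' w' where uw': "u' \<in> X" "w' \<in> Y" "E u' w'" "cw_label d u = cw_label d u'"
      "cw_label d w = cw_label d w'" unfolding R_def by blast
    have u: "u \<in> X" "cw_label s u = cw_label s u'" using dsame[of u u'] that uw' layout_join.hyps by auto
    have w: "w \<in> Y" "cw_label t w = cw_label t w'" using dsame[of w w'] that uw' layout_join.hyps by auto
    have eq: "ext_nbhd V E X u = ext_nbhd V E X u'" "ext_nbhd V E Y w = ext_nbhd V E Y w'"
      using s(6)[OF u(1) uw'(1) u(2)] t(6)[OF w(1) uw'(2) w(2)] by blast+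
    have "w' \<in> ext_nbhd V E X u'" using uw' sub layout_join.hyps by (auto simp: ext_nbhd_def)
    then have "E w' u" using eq assms(2) by (auto simp: ext_nbhd_def dest: sympD)
    then have "u \<in> ext_nbhd V E Y w'" using u sub layout_join.hyps by (auto simp: ext_nbhd_def)
    then have "E w u" using eq by (auto simp: ext_nbhd_def)
    then show "u \<in> X \<and> w \<in> Y \<and> E u w" using u w assms(2) by (auto dest: sympD)
  qed (auto simp: R_def)
  from ex_cw_joins[OF R d(1)] obtain d' :: "('a, nat) cw_expr" where
    d': "cw_valid d'" "cw_verts d' = ?Z" "cw_label d' = cw_label d"
      "cw_labels d' \<subseteq> cw_labels d \<union> fst ` R \<union> snd ` R"
      "cw_arcs d' = cw_arcs d \<union> {(u, w). u \<in> ?Z \<and> w \<in> ?Z \<and>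
        ((cw_label d u, cw_label d w) \<in> R \<or> (cw_label d w, cw_label d u) \<in> R)}"
    unfolding d(2) by (elim exE conjE)
  have arcs: "cw_arcs d' = {(u, w). u \<in> ?Z \<and> w \<in> ?Z \<and> E u w}"
  proof -
    have "{(u, w). u \<in> ?Z \<and> w \<in> ?Z \<and>
        ((cw_label d u, cw_label d w) \<in> R \<or> (cw_label d w, cw_label d u) \<in> R)} =
      {(u, w). (u \<in> X \<and> w \<in> Y \<and> E u w) \<or> (w \<in> X \<and> u \<in> Y \<and> E w u)}"
      using R_iff by blast
    moreover have "cw_arcs d = {(u, w). u \<in> X \<and> w \<in> X \<and> E u w} \<union> {(u, w). u \<in> Y \<and> w \<in> Y \<and> E u w}"
      using s(3) t(3) t'(3) by (simp add: d_def)
    moreover have "E u w \<longleftrightarrow> E w u" for u w using assms(2) by (metis sympD)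
    ultimately show ?thesis unfolding d'(5) by blast
  qed
  have labs: "cw_labels d' \<subseteq> {..<3 * m}" using d'(4) d(3) R_sub by fastforce
  let ?T = "ext_nbhd V E ?Z ` ?Z"
  have "card ?T \<le> card (insert {} (ext_nbhds V E ?Z))"
    using sub by (intro card_mono) (auto simp: ext_nbhds_def)
  also have "\<dots> \<le> card (ext_nbhds V E ?Z) + 1"
    using sub by (simp add: card_insert_if finite_ext_nbhds)
  also have "\<dots> \<le> m" using layout_join.hyps by (simp add: m_def)
  finally have card_T: "card ?T \<le> m" .
  obtain h :: "'a set \<Rightarrow> nat" where bij: "bij_betw h ?T {0..<card ?T}"
    using ex_bij_betw_finite_nat[of ?T] sub by auto
  have h: "inj_on h ?T" "h T < m" if "T \<in> ?T" for T
  proof -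
    show "inj_on h ?T" using bij by (simp add: bij_betw_def)
    have "h T \<in> {0..<card ?T}" using bij that by (rule bij_betwE[rule_format])
    then show "h T < m" using card_T by simp
  qed
  define code where "code u = h (ext_nbhd V E ?Z u)" for u
  have code: "code u < m" if "u \<in> ?Z" for u using h(2) that by (simp add: code_def)
  have code_cong: "code u = code w" if uw: "u \<in> ?Z" "w \<in> ?Z" "cw_label d u = cw_label d w" for u w
  proof -
    have "ext_nbhd V E ?Z u = ext_nbhd V E ?Z w"
      using dsame[OF uw] s(6)[of u w] t(6)[of u w] by (auto simp: ext_nbhd_def set_eq_iff)
    then show ?thesis by (simp add: code_def)
  qed
  \<comment> \<open>\<open>g\<close> sends a label of \<open>d\<close> to the number of the outer
    neighbourhood of its vertices, shifted into the third block; by \<open>code_cong\<close> the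
    chosen vertex does not matter. For labels that do not occur the default 0 keeps the value inside
    that block.\<close>
  define g where "g i = 2 * m + (if \<exists>u\<in>?Z. cw_label d u = i
    then code (SOME u. u \<in> ?Z \<and> cw_label d u = i) else 0)" for i
  have g: "g (cw_label d u) = 2 * m + code u" if "u \<in> ?Z" for u
  proof -
    let ?u = "SOME w. w \<in> ?Z \<and> cw_label d w = cw_label d u"
    have "?u \<in> ?Z \<and> cw_label d ?u = cw_label d u"
      using that by (rule_tac someI[of _ u]) simp
    then show ?thesis using that code_cong[of ?u u] by (auto simp: g_def)
  qed
  have g_less: "g i < 3 * m" for i
  proof (cases "\<exists>u\<in>?Z. cw_label d u = i")
    case True
    then show ?thesis using g code by fastforce
  next
    case False
    then show ?thesis by (simp add: g_def m_def)
  qed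
  have "g ` {..<2 * m} \<inter> {..<2 * m} = {}" by (auto simp: g_def)
  from ex_cw_relabel[OF _ this d'(1)] obtain e :: "('a, nat) cw_expr" where
    e: "cw_valid e" "cw_verts e = ?Z" "cw_arcs e = cw_arcs d'"
      "cw_labels e \<subseteq> cw_labels d' \<union> {..<2 * m} \<union> g ` {..<2 * m}"
      "\<And>u. cw_label e u = (if cw_label d u \<in> {..<2 * m} then g (cw_label d u) else cw_label d u)"
    using d'(2,3) by auto
  have eZ: "cw_label e u = 2 * m + code u" if "u \<in> ?Z" for u
  proof -
    have "cw_label d u < 2 * m" using that dX dY s(5)[of u] t(5)[of u] by fastforce
    then show ?thesis using e(5) g[OF that] by simp
  qed
  \<comment> \<open>The third block is moved back to the first, which restores the label bound of
    the induction.\<close>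
  have "(\<lambda>i. i - 2 * m) ` {2 * m..<3 * m} \<inter> {2 * m..<3 * m} = {}" by auto
  from ex_cw_relabel[OF _ this e(1)] obtain f :: "('a, nat) cw_expr" where
    f: "cw_valid f" "cw_verts f = ?Z" "cw_arcs f = cw_arcs d'"
      "cw_labels f \<subseteq> cw_labels e \<union> {2 * m..<3 * m} \<union> (\<lambda>i. i - 2 * m) ` {2 * m..<3 * m}"
      "\<And>u. cw_label f u = (if cw_label e u \<in> {2 * m..<3 * m} then cw_label e u - 2 * m else cw_label e u)"
    using e(2,3) by auto
  have fZ: "cw_label f u = code u" if "u \<in> ?Z" for u
    using f(5) eZ[OF that] code[OF that] by simp
  have "cw_labels f \<subseteq> {..<3 * m}"
  proof -
    have "g ` {..<2 * m} \<subseteq> {..<3 * m}" using g_less by blast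
    moreover have sub3: "{..<2 * m} \<subseteq> {..<3 * m}" "{2 * m..<3 * m} \<subseteq> {..<3 * m}"
      "(\<lambda>i. i - 2 * m) ` {2 * m..<3 * m} \<subseteq> {..<3 * m}" by auto
    ultimately have "cw_labels e \<subseteq> {..<3 * m}"
      using labs by (intro order_trans[OF e(4)] Un_least)
    with sub3 show ?thesis by (intro order_trans[OF f(4)] Un_least)
  qed
  moreover have "ext_nbhd V E ?Z u = ext_nbhd V E ?Z w"
    if "u \<in> ?Z" "w \<in> ?Z" "cw_label f u = cw_label f w" for u w
  proof -
    have "h (ext_nbhd V E ?Z u) = h (ext_nbhd V E ?Z w)" using that fZ by (metis code_def)
    then show ?thesis using h(1) that by (meson imageI inj_onD)
  qed
  moreover have "cw_label f u < m" if "u \<in> ?Z" for u using fZ[OF that] code[OF that] by simp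
  ultimately show ?case
    using f(1,2,3) arcs unfolding m_def[symmetric] by (intro exI[of _ f]) blast
qed

lemma pair_graph_symp_irrefl:
  assumes "pair_graph G"
  shows "symp (\<lambda>u w. (u, w) \<in> parcs G)" "(u, u) \<notin> parcs G"
proof -
  interpret pair_graph G by fact
  show "symp (\<lambda>u w. (u, w) \<in> parcs G)"
    using pair_sym_arcs by (auto simp: symmetric_def sym_def symp_def)
  show "(u, u) \<notin> parcs G" using pair_no_loops[of "(u, u)"] by auto
qed

lemma clique_width_le_of_width_le:
  assumes "pair_graph G" "width_le (pverts G) (\<lambda>u w. (u, w) \<in> parcs G) k"
  shows "clique_width G \<le> 3 * (k + 1)"
proof (cases "pverts G = {}")
  case False
  interpret pair_graph G by fact
  let ?E = "\<lambda>u w. (u, w) \<in> parcs G"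
  note pair_graph_symp_irrefl[OF assms(1)]
  moreover have "layout (pverts G) ?E k (pverts G)" using assms(2) False by (simp add: width_le_def)
  ultimately obtain s :: "('a, nat) cw_expr" where
    s: "cw_valid s" "cw_verts s = pverts G"
      "cw_arcs s = {(u, w). u \<in> pverts G \<and> w \<in> pverts G \<and> ?E u w}" "cw_labels s \<subseteq> {..<3 * (k + 1)}"
    using ex_cw_expr_layout[of "pverts G" ?E k "pverts G"] by auto
  have "cw_arcs s = parcs G" using s(3) in_arcsD1 in_arcsD2 by auto
  then have "cw_graph s = G" using s(2) by (simp add: cw_graph_def)
  then have "clique_width G \<le> card (cw_labels s)"
    using False s(1) by (auto simp: clique_width_def intro!: Least_le)
  also have "\<dots> \<le> card {..<3 * (k + 1)}" using s(4) by (intro card_mono) auto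
  finally show ?thesis by simp
qed (simp add: clique_width_def)

section \<open>Triangle-free graphs without an induced chair\<close>

locale triangle_free_graph =
  fixes V :: "'a set" and E :: "'a \<Rightarrow> 'a \<Rightarrow> bool"
  assumes finV: "finite V" and symE: "symp E" and irrE: "\<not> E u u"
    and triangle_free: "u \<in> V \<Longrightarrow> v \<in> V \<Longrightarrow> w \<in> V \<Longrightarrow> E u v \<Longrightarrow> E v w \<Longrightarrow> E u w \<Longrightarrow> False"
begin

lemma E_commute: "E u w \<longleftrightarrow> E w u"
  using symE by (metis sympD)

lemma triangle_free_subset:
  assumes "U \<subseteq> V"
  shows "triangle_free_graph U E"
proof
  show "finite U" using assms finV finite_subset by blast
  fix u v w assume "u \<in> U" "v \<in> U" "w \<in> U" "E u v" "E v w" "E u w"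
  then show False using assms triangle_free[of u v w] by blast
qed (use symE irrE in auto)

text \<open>In a connected triangle-free graph without an induced chair, a vertex \<open>x\<close> of degree at least 3
  forces an almost complete bipartite graph: \<open>P\<close> is the neighbourhood of \<open>x\<close>, the vertices at
  distance 0 or 2 from \<open>x\<close> form \<open>Q\<close>, the non-edges between \<open>P\<close> and \<open>Q\<close> form a matching, and at most
  one vertex \<open>R\<close> remains.\<close>

lemma width_le_chair_free_connected:
  assumes chair_free: "\<And>x a b c d. x \<in> V \<Longrightarrow> a \<in> V \<Longrightarrow> b \<in> V \<Longrightarrow> c \<in> V \<Longrightarrow> d \<in> V \<Longrightarrow>
      E x a \<Longrightarrow> E x b \<Longrightarrow> E x c \<Longrightarrow> E c d \<Longrightarrow> \<not> E a d \<Longrightarrow> \<not> E b d \<Longrightarrow> a = b"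
    and conn: "conn_graph V E" and x: "x \<in> V" "3 \<le> card {w \<in> V. E x w}"
  shows "width_le V E 16"
proof -
  define P where "P = {w \<in> V. E x w}"
  define Q where "Q = {z \<in> V - P. \<exists>p\<in>P. E z p}"
  define R where "R = {f \<in> V - P - Q. \<exists>d\<in>Q. E f d}"
  have PV: "p \<in> V" "E x p" "E p x" if "p \<in> P" for p using that E_commute by (auto simp: P_def)
  have QV: "q \<in> V" "q \<notin> P" if "q \<in> Q" for q using that by (auto simp: Q_def)
  have RV: "f \<in> V" "f \<notin> P" "f \<notin> Q" "\<not> E x f" "\<not> E f x" if "f \<in> R" for f
    using that E_commute by (auto simp: R_def P_def)
  have P_indep: "\<not> E p p'" if "p \<in> P" "p' \<in> P" for p p'
    using that PV x triangle_free[of x p p'] by blast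
  have PR: "\<not> E p f" "\<not> E f p" if "p \<in> P" "f \<in> R" for p f
    using that E_commute by (auto simp: Q_def R_def)
  obtain p1 p2 p3 where p123: "p1 \<in> P" "p2 \<in> P" "p3 \<in> P" "p1 \<noteq> p2" "p1 \<noteq> p3" "p2 \<noteq> p3"
    using ex_three_of_card_ge_3[OF x(2)[folded P_def]] by metis
  \<comment> \<open>A chair centred at \<open>x\<close> with leaves \<open>p\<close>,
    \<open>p'\<close> and leg \<open>c\<close>, \<open>q\<close> shows that \<open>q\<close> misses
    at most one vertex of \<open>P\<close>.\<close>
  have miss: "p = p'" if q: "q \<in> Q" "p \<in> P" "p' \<in> P" "\<not> E q p" "\<not> E q p'" for q p p'
  proof -
    obtain c where "c \<in> P" "E q c" using q(1) by (auto simp: Q_def)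
    then show ?thesis
      using chair_free[of x p p' c q] q PV QV x E_commute by blast
  qed
  have common: "\<exists>p\<in>P. E q p \<and> E q' p" if "q \<in> Q" "q' \<in> Q" for q q'
    using miss[OF that(1)] miss[OF that(2)] p123 by metis
  have Q_indep: "\<not> E q q'" if "q \<in> Q" "q' \<in> Q" for q q'
    using common[OF that] that QV PV triangle_free E_commute by blast
  \<comment> \<open>Otherwise there is a chair centred at a neighbour \<open>d\<close> of
    \<open>f\<close> in \<open>Q\<close>, with leaves \<open>p\<close>, \<open>p'\<close> and leg
    \<open>f\<close>, \<open>w\<close>.\<close>
  have R_nbr: "w \<in> Q" if f: "f \<in> R" and w: "w \<in> V" "E f w" for f w
  proof (rule ccontr)
    assume "w \<notin> Q"
    have "w \<notin> P" using f w PR by blast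
    then have no: "\<not> E p w" if "p \<in> P" for p
      using that \<open>w \<notin> Q\<close> w E_commute by (auto simp: Q_def)
    obtain d where d: "d \<in> Q" "E f d" using f by (auto simp: R_def)
    obtain p p' where "p \<in> P" "p' \<in> P" "p \<noteq> p'" "E d p" "E d p'"
      using miss[OF d(1)] p123 by metis
    then show False
      using chair_free[of d p p' f w] no d w f PV QV RV E_commute by blast
  qed
  have "P \<union> Q \<union> R = V"
  proof (rule conn_graphD[OF conn])
    show "P \<union> Q \<union> R \<subseteq> V" by (auto simp: P_def Q_def R_def)
    show "p1 \<in> P \<union> Q \<union> R" using p123 by blast
    fix u w assume u: "u \<in> P \<union> Q \<union> R" and w: "w \<in> V" "E u w"
    have "E w u" using w E_commute by blast
    then show "w \<in> P \<union> Q \<union> R"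
      using u w(1) R_nbr[OF _ w] unfolding Q_def R_def by blast
  qed
  then have cover: "u \<in> P \<or> u \<in> Q \<or> u \<in> R" if "u \<in> V" for u using that by blast
  \<comment> \<open>If \<open>f\<close> and \<open>f'\<close> share a neighbour \<open>d\<close> in
    \<open>Q\<close>, a chair is centred at \<open>d\<close> with leg \<open>p\<close>,
    \<open>x\<close>. If not, a chair is centred at a common neighbour \<open>p\<close> of
    \<open>d\<close> and \<open>d'\<close>, with leaves \<open>x\<close>, \<open>d'\<close> and leg
    \<open>d\<close>, \<open>f\<close>.\<close>
  have R_one: "f = f'" if f: "f \<in> R" and f': "f' \<in> R" for f f'
  proof (rule ccontr)
    assume ne: "f \<noteq> f'"
    have sole: "\<not> E d f'" if d: "d \<in> Q" "E d f" and f: "f \<in> R" "f' \<in> R" "f \<noteq> f'" for d f f'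
    proof
      assume "E d f'"
      obtain p where "p \<in> P" "E d p" using d by (auto simp: Q_def)
      then show False
        using chair_free[of d f f' p x] \<open>E d f'\<close> d f x PV QV RV by blast
    qed
    obtain d d' where d: "d \<in> Q" "E d f" and d': "d' \<in> Q" "E d' f'"
      using f f' E_commute by (auto simp: R_def)
    have no: "\<not> E d' f" using sole[OF d' f' f] ne by blast
    obtain p where p: "p \<in> P" "E d p" "E d' p" using common d d' by blast
    have "x = d'"
      using chair_free[of p x d' d f] p no d d' f x PV QV RV E_commute by blast
    then show False using d' f' RV by blast
  qed
  \<comment> \<open>Another vertex \<open>p'\<close> of \<open>P\<close> sees both \<open>q\<close>
    and \<open>q'\<close>, as each misses only \<open>p\<close>. It is the centre of a chair with
    these leaves and leg \<open>x\<close>, \<open>p\<close>.\<close>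
  have miss': "q = q'" if p: "p \<in> P" and q: "q \<in> Q" "q' \<in> Q" "\<not> E p q" "\<not> E p q'" for p q q'
  proof -
    obtain p' where p': "p' \<in> P" "p' \<noteq> p" using p123 by metis
    then have "E q p'" "E q' p'" using miss p q E_commute by blast+
    then show ?thesis
      using chair_free[of p' q q' x p] p p' q x PV QV E_commute by blast
  qed
  define E' where "E' u w \<longleftrightarrow> \<not> E u w \<and> (u \<in> P \<and> w \<in> Q \<or> u \<in> Q \<and> w \<in> P)" for u w
  have wd': "width_le V E' 1"
  proof (rule width_le_degree_le_1[OF finV])
    show "symp E'" using E_commute by (auto simp: E'_def symp_def)
    fix u assume "u \<in> V"
    have "w = w'" if "E' u w" "E' u w'" for w w'
      using that miss miss' QV(2) unfolding E'_def by blast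
    then show "card {w \<in> V. E' u w} \<le> 1"
      using finV card_le_Suc0_iff_eq[of "{w \<in> V. E' u w}"] by auto
  qed
  \<comment> \<open>Besides membership in \<open>P\<close> and \<open>Q\<close>, a class only has to
    record whether it sees the single possible vertex of \<open>R\<close>. The 8 classes and the
    matching \<open>E'\<close> give 8 * (1 + 1) = 16.\<close>
  define c where "c u = (u \<in> P, u \<in> Q, \<exists>f\<in>R. E u f)" for u
  have "card (c ` V) \<le> card ({True, False} \<times> {True, False} \<times> {True, False})"
    by (intro card_mono) (auto simp: c_def)
  then have card_c: "card (c ` V) \<le> 8" by (simp add: card_cartesian_product)
  have flip: "(E y w \<longleftrightarrow> E' y w) \<longleftrightarrow> (E z w \<longleftrightarrow> E' z w)"
    if yz: "y \<in> V" "z \<in> V" "c y = c z" and w: "w \<in> V" for y z w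
  proof -
    have yz': "y \<in> P \<longleftrightarrow> z \<in> P" "y \<in> Q \<longleftrightarrow> z \<in> Q" "(\<exists>f\<in>R. E y f) \<longleftrightarrow> (\<exists>f\<in>R. E z f)"
      using yz by (auto simp: c_def)
    have ER: "E u w \<longleftrightarrow> (\<exists>f\<in>R. E u f)" if "w \<in> R" for u using that R_one by blast
    show ?thesis
    proof (cases "y \<in> R")
      case True
      then have "z \<in> R" using cover[OF yz(2)] RV(2,3)[OF True] yz'(1,2) by blast
      then have "z = y" using True R_one by blast
      then show ?thesis by simp
    next
      case False
      then have yzPQ: "y \<in> P \<and> z \<in> P \<or> y \<in> Q \<and> z \<in> Q" using cover[OF yz(1)] yz'(1,2) by blast
      consider "w \<in> P" | "w \<in> Q" | "w \<in> R" using cover[OF w] by blast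
      then show ?thesis
      proof cases
        case 1
        then show ?thesis using yzPQ P_indep QV(2) unfolding E'_def by blast
      next
        case 2
        then show ?thesis using yzPQ Q_indep QV(2) unfolding E'_def by blast
      next
        case 3
        then have "\<not> E' y w" "\<not> E' z w" using RV(2,3)[OF 3] unfolding E'_def by blast+
        then show ?thesis using ER[OF 3] yz'(3) by blast
      qed
    qed
  qed
  have "width_le V E (8 * (1 + 1))"
    by (rule width_le_flip[OF wd' finite_imageI[OF finV] card_c]) (rule flip)
  then show ?thesis by simp
qed

lemma width_le_chair_free:
  assumes chair_free: "\<And>x a b c d. x \<in> V \<Longrightarrow> a \<in> V \<Longrightarrow> b \<in> V \<Longrightarrow> c \<in> V \<Longrightarrow> d \<in> V \<Longrightarrow>
      E x a \<Longrightarrow> E x b \<Longrightarrow> E x c \<Longrightarrow> E c d \<Longrightarrow> \<not> E a d \<Longrightarrow> \<not> E b d \<Longrightarrow> a = b"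
  shows "width_le V E 16"
proof (rule width_le_components[OF finV symE])
  fix U assume U: "U \<subseteq> V" "conn_graph U E"
  interpret U: triangle_free_graph U E using U by (intro triangle_free_subset)
  show "width_le U E 16"
  proof (cases "\<forall>u\<in>U. card {w \<in> U. E u w} \<le> 2")
    case True
    then have "width_le U E 8" by (intro width_le_degree_le_2 U.finV symE) auto
    then show ?thesis by (rule width_le_mono) simp
  next
    case False
    then obtain x where x: "x \<in> U" "3 \<le> card {w \<in> U. E x w}" by force
    show ?thesis
    proof (rule U.width_le_chair_free_connected[OF _ U(2) x])
      fix x a b c d
      assume "x \<in> U" "a \<in> U" "b \<in> U" "c \<in> U" "d \<in> U" "E x a" "E x b" "E x c" "E c d" "\<not> E a d" "\<not> E b d"
      then show "a = b" using chair_free[of x a b c d] U(1) by blast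
    qed
  qed
qed

end

section \<open>Vertices of high degree\<close>

lemma card_le_2_of_no_three:
  assumes "finite S" "\<And>a b c. a \<in> S \<Longrightarrow> b \<in> S \<Longrightarrow> c \<in> S \<Longrightarrow> a = b \<or> a = c \<or> b = c"
  shows "card S \<le> 2"
proof (rule ccontr)
  assume "\<not> card S \<le> 2"
  then have "3 \<le> card S" by simp
  then obtain a b c where "a \<in> S" "b \<in> S" "c \<in> S" "a \<noteq> b" "a \<noteq> c" "b \<noteq> c"
    by (rule ex_three_of_card_ge_3)
  then show False using assms(2) by blast
qed

lemma card_le_1_of_no_two:
  assumes "finite S" "\<And>a b. a \<in> S \<Longrightarrow> b \<in> S \<Longrightarrow> a = b"
  shows "card S \<le> 1"
  using card_le_Suc0_iff_eq[OF assms(1)] assms(2) by simp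

text \<open>The remaining non-edges of the chair follow from triangle-freeness. That
  \<open>z\<close> lies off the chair follows because every vertex of the chair has a neighbour on
  it.\<close>

locale p1_chair_free_graph = triangle_free_graph +
  assumes p1_chair_free: "z \<in> V \<Longrightarrow> x \<in> V \<Longrightarrow> a \<in> V \<Longrightarrow> b \<in> V \<Longrightarrow> c \<in> V \<Longrightarrow> d \<in> V \<Longrightarrow> a \<noteq> b \<Longrightarrow>
    E x a \<Longrightarrow> E x b \<Longrightarrow> E x c \<Longrightarrow> E c d \<Longrightarrow> \<not> E a d \<Longrightarrow> \<not> E b d \<Longrightarrow>
    \<not> E z x \<Longrightarrow> \<not> E z a \<Longrightarrow> \<not> E z b \<Longrightarrow> \<not> E z c \<Longrightarrow> \<not> E z d \<Longrightarrow> False"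

text \<open>The threshold 7 comes from the counting in \<open>card_N_low\<close>: three sets of at
  least half the size of the neighbourhood of \<open>v\<close> that pairwise share at most one
  element leave room for at most 6 neighbours.\<close>

locale high_degree_vertex = p1_chair_free_graph +
  fixes v
  assumes vV: "v \<in> V" and degree_v: "7 \<le> card {w \<in> V. E v w}"
begin

section \<open>Neighbourhoods in \<open>A\<close> of the non-neighbours of \<open>v\<close>\<close>

definition A where "A = {w \<in> V. E v w}"
definition B where "B = V - A - {v}"
definition N where "N d = {a \<in> A. E d a}"
definition M where "M d = {a \<in> A. \<not> E d a}"

text \<open>The inequality is strict so that any two members of \<open>H\<close> have a common
  neighbour in \<open>A\<close>.\<close>

definition H where "H = {d \<in> B. 2 * card (M d) < card A}"
definition T0 where "T0 = {d \<in> B. N d = {}}"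

lemma card_A: "7 \<le> card A" using degree_v by (simp add: A_def)
lemma finA [simp]: "finite A" using finV by (simp add: A_def)
lemma finB [simp]: "finite B" using finV by (simp add: B_def)
lemma finM [simp]: "finite (M d)" by (simp add: M_def)
lemma finN [simp]: "finite (N d)" by (simp add: N_def)
lemma A_V: "a \<in> A \<Longrightarrow> a \<in> V" by (simp add: A_def)
lemma B_V: "d \<in> B \<Longrightarrow> d \<in> V" by (simp add: B_def)
lemma H_B: "h \<in> H \<Longrightarrow> h \<in> B" by (simp add: H_def)
lemma T0_B: "t \<in> T0 \<Longrightarrow> t \<in> B" by (simp add: T0_def)
lemma finH [simp]: "finite H" by (rule finite_subset[OF _ finB]) (auto simp: H_def)
lemma v_A: "a \<in> A \<Longrightarrow> E v a" "a \<in> A \<Longrightarrow> E a v" using E_commute by (auto simp: A_def)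
lemma v_B: "d \<in> B \<Longrightarrow> \<not> E v d" "d \<in> B \<Longrightarrow> \<not> E d v" using E_commute by (auto simp: A_def B_def)
lemma in_M: "a \<in> M d \<longleftrightarrow> a \<in> A \<and> \<not> E d a" by (simp add: M_def)
lemma in_N: "a \<in> N d \<longleftrightarrow> a \<in> A \<and> E d a" by (simp add: N_def)
lemma M_eq_iff: "M d = M e \<longleftrightarrow> N d = N e" by (auto simp: M_def N_def)
lemma M_subset: "M d \<subseteq> A" by (auto simp: M_def)

lemma A_indep: "a \<in> A \<Longrightarrow> b \<in> A \<Longrightarrow> \<not> E a b"
  using triangle_free[of v a b] v_A A_V vV by blast

lemma T0_A: "t \<in> T0 \<Longrightarrow> a \<in> A \<Longrightarrow> \<not> E t a" "t \<in> T0 \<Longrightarrow> a \<in> A \<Longrightarrow> \<not> E a t"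
  using E_commute by (auto simp: T0_def N_def)

lemma T0_M: "t \<in> T0 \<Longrightarrow> M t = A"
  using T0_A by (auto simp: M_def)

text \<open>If \<open>c\<close> is in \<open>N d\<close> but not in \<open>N e\<close>, then
  \<open>v\<close> is the centre of a chair with leaves \<open>a\<close>, \<open>b\<close> and leg
  \<open>c\<close>, \<open>d\<close>, and \<open>e\<close> sees none of it.\<close>

lemma nonadjacent_subset_or:
  assumes "d \<in> B" "e \<in> B" "\<not> E d e" "a \<in> M d" "a \<in> M e" "b \<in> M d" "b \<in> M e" "a \<noteq> b"
  shows "N d \<subseteq> N e"
proof
  fix c assume c: "c \<in> N d"
  show "c \<in> N e"
  proof (rule ccontr)
    assume "c \<notin> N e"
    then show False
      using p1_chair_free[of e v a b c d] assms c vV v_A v_B A_V B_V E_commute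
      unfolding in_M in_N by blast
  qed
qed

lemma nonadjacent_M_meet:
  assumes "d \<in> B" "e \<in> B" "\<not> E d e" "N d \<noteq> N e" "a \<in> M d" "a \<in> M e" "b \<in> M d" "b \<in> M e"
  shows "a = b"
proof (rule ccontr)
  assume ne: "a \<noteq> b"
  have "N d \<subseteq> N e" by (rule nonadjacent_subset_or[OF assms(1-3,5-8) ne])
  moreover have "\<not> E e d" using assms(3) E_commute by blast
  then have "N e \<subseteq> N d" by (rule nonadjacent_subset_or[OF assms(2,1) _ assms(6,5,8,7) ne])
  ultimately show False using assms(4) by blast
qed

lemma card_M_Int_le_1:
  assumes "d \<in> B" "e \<in> B" "\<not> E d e" "N d \<noteq> N e"
  shows "card (M d \<inter> M e) \<le> 1"
  using nonadjacent_M_meet[OF assms] by (intro card_le_1_of_no_two) auto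

lemma H_common:
  assumes "h \<in> H" "e \<in> H"
  obtains a where "a \<in> A" "E h a" "E e a"
proof -
  have "card (M h \<union> M e) \<le> card (M h) + card (M e)" by (rule card_Un_le)
  also have "\<dots> < card A" using assms by (simp add: H_def)
  finally have "M h \<union> M e \<noteq> A" by auto
  then show ?thesis using that by (auto simp: M_def)
qed

lemma H_indep: "h \<in> H \<Longrightarrow> e \<in> H \<Longrightarrow> \<not> E h e"
  using triangle_free H_common E_commute A_V B_V H_B by metis

lemma H_M_meet:
  assumes "h \<in> H" "e \<in> H" "N h \<noteq> N e" "a \<in> M h" "a \<in> M e" "b \<in> M h" "b \<in> M e"
  shows "a = b"
  using nonadjacent_M_meet[of h e a b] assms H_B[of h] H_B[of e] H_indep[of h e] by blast

text \<open>If \<open>b\<close> and \<open>b'\<close> were distinct, \<open>h\<close> would be the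
  centre of a chair with leaves \<open>b\<close>, \<open>b'\<close> and leg \<open>c\<close>,
  \<open>e\<close>, where \<open>c\<close> is a common neighbour; the vertex \<open>a\<close> sees
  none of it.\<close>

lemma H_meet_card_Diff:
  assumes "h \<in> H" "e \<in> H" "a \<in> M h" "a \<in> M e"
  shows "card (M e - M h) \<le> 1"
proof (rule card_le_1_of_no_two)
  fix b b' assume b: "b \<in> M e - M h" "b' \<in> M e - M h"
  obtain c where c: "c \<in> A" "E h c" "E e c" using assms(1,2) by (rule H_common)
  have a: "a \<in> A" "\<not> E h a" "\<not> E e a" using assms(3,4) by (auto simp: in_M)
  have b': "b \<in> A" "b' \<in> A" "E h b" "E h b'" "\<not> E e b" "\<not> E e b'" using b by (auto simp: in_M)
  have V: "a \<in> V" "h \<in> V" "b \<in> V" "b' \<in> V" "c \<in> V" "e \<in> V"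
    using a b' c assms(1,2) A_V B_V H_B by auto
  have "\<not> E a h" "\<not> E a e" "E c e" "\<not> E b e" "\<not> E b' e"
    using a b' c E_commute[of _ h] E_commute[of _ e] by auto
  moreover have "\<not> E a b" "\<not> E a b'" "\<not> E a c" using a b' c A_indep by auto
  ultimately show "b = b'"
    using p1_chair_free[of a h b b' c e] V b' c by blast
qed simp

text \<open>At most one element is shared with \<open>M h\<close> and at most one is not. This
  bounds the degree of \<open>e\<close> in the graph of non-edges between \<open>A\<close> and
  \<open>H\<close>.\<close>

lemma H_meet_card_M:
  assumes "h \<in> H" "e \<in> H" "N h \<noteq> N e" "a \<in> M h" "a \<in> M e"
  shows "card (M e) \<le> 2"
proof -
  have "card (M e) = card (M e \<inter> M h) + card (M e - M h)"
    by (rule card_Int_Diff) simp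
  moreover have "card (M e \<inter> M h) \<le> 1"
    using assms H_B H_indep by (intro card_M_Int_le_1) auto
  moreover have "card (M e - M h) \<le> 1" using H_meet_card_Diff[OF assms(1,2,4,5)] .
  ultimately show ?thesis by linarith
qed

text \<open>Otherwise \<open>a\<close> is the centre of a chair with leaves \<open>d\<close>,
  \<open>e\<close> and leg \<open>v\<close>, \<open>b\<close>, and \<open>f\<close> sees none of
  it.\<close>

lemma H_pair_unique:
  assumes "f \<in> H" "a \<in> M f" "b \<in> M f" and "d \<in> H" "b \<in> M d" "a \<notin> M d"
    and "e \<in> H" "b \<in> M e" "a \<notin> M e"
  shows "d = e"
proof (rule ccontr)
  assume ne: "d \<noteq> e"
  have a: "a \<in> A" and b: "b \<in> A" using assms(2,3) by (auto simp: in_M)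
  have V: "f \<in> V" "a \<in> V" "b \<in> V" "d \<in> V" "e \<in> V"
    using a b assms(1,4,7) A_V B_V H_B by auto
  have adj: "E a d" "E a e" using assms(6,9) a E_commute[of a] by (auto simp: in_M)
  have nadj: "\<not> E d b" "\<not> E e b" "\<not> E f a" "\<not> E f b" using assms(2,3,5,8) by (auto simp: in_M)
  have "\<not> E f d" "\<not> E f e" "\<not> E f v" using assms(1,4,7) H_indep v_B H_B by auto
  then show False
    using p1_chair_free[of f a d e v b] V vV ne adj nadj v_A[OF a] v_A[OF b] by blast
qed

text \<open>Of three vertices that miss \<open>b\<close> and have different neighbourhoods, one
  misses a further vertex \<open>a\<close>. The other two see \<open>a\<close>, so
  \<open>H_pair_unique\<close> identifies them. Up to twins, this bounds the degree of
  \<open>b\<close> in the graph of non-edges.\<close>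

lemma card_N_containing:
  assumes "b \<in> A"
  shows "card (N ` {h \<in> H. b \<in> M h}) \<le> 2"
proof (rule card_le_2_of_no_three)
  fix S1 S2 S3
  assume "S1 \<in> N ` {h \<in> H. b \<in> M h}" "S2 \<in> N ` {h \<in> H. b \<in> M h}" "S3 \<in> N ` {h \<in> H. b \<in> M h}"
  then obtain h1 h2 h3 where h: "h1 \<in> H" "h2 \<in> H" "h3 \<in> H" "b \<in> M h1" "b \<in> M h2" "b \<in> M h3"
    and S: "S1 = N h1" "S2 = N h2" "S3 = N h3" by blast
  show "S1 = S2 \<or> S1 = S3 \<or> S2 = S3"
  proof (rule ccontr)
    assume "\<not> (S1 = S2 \<or> S1 = S3 \<or> S2 = S3)"
    then have ne: "N h1 \<noteq> N h2" "N h1 \<noteq> N h3" "N h2 \<noteq> N h3" using S by auto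
    have pair: False if p: "{p, q, r} \<subseteq> H" "b \<in> M p" "b \<in> M q" "b \<in> M r"
      "N p \<noteq> N q" "N p \<noteq> N r" "N q \<noteq> N r" "M p \<noteq> {b}" for p q r
    proof -
      obtain a where a: "a \<in> M p" "a \<noteq> b" using p by blast
      have "a \<notin> M q" "a \<notin> M r"
        using H_M_meet[of p q a b] H_M_meet[of p r a b] a p by auto
      then have "q = r" using H_pair_unique[of p a b q r] a p by simp
      then show False using p by simp
    qed
    have "M h1 \<noteq> M h2" using ne M_eq_iff by blast
    then consider "M h1 \<noteq> {b}" | "M h2 \<noteq> {b}" by blast
    then show False
    proof cases
      case 1
      then show False using pair[of h1 h2 h3] h ne by simp
    next
      case 2
      then show False using pair[of h2 h1 h3] h ne by (simp add: eq_commute)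
    qed
  qed
qed simp

text \<open>Fix one vertex \<open>d\<close> outside of \<open>H\<close>. Its neighbours are pairwise
  non-adjacent and show at most two neighbourhoods in \<open>A\<close>; three further neighbourhoods
  among its non-neighbours would force a triangle. With \<open>N d\<close> this makes 1 + 2 +
  2.\<close>

lemma card_N_low: "card (N ` (B - H)) \<le> 5"
proof (cases "B - H = {}")
  case False
  then obtain d where d: "d \<in> B - H" by blast
  let ?S = "N ` {e \<in> B - H. E d e}" and ?T = "N ` {e \<in> B - H. \<not> E d e \<and> N e \<noteq> N d}"
  have large: "card A \<le> 2 * card (M e)" if "e \<in> B - H" for e using that by (auto simp: H_def)
  \<comment> \<open>The sets of non-neighbours have at least half the size of \<open>A\<close> and
    pairwise share at most one element, so three of them would give
    \<open>3 * card A \<le> 2 * (card A + 3)\<close>, which contradicts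
    \<open>card_A\<close>.\<close>
  have three: "N p = N q \<or> N p = N r \<or> N q = N r"
    if p: "p \<in> B - H" "q \<in> B - H" "r \<in> B - H" "\<not> E p q" "\<not> E p r" "\<not> E q r" for p q r
  proof (rule ccontr)
    assume ne: "\<not> ?thesis"
    have pq: "card (M p \<inter> M q) \<le> 1" using p ne by (intro card_M_Int_le_1) auto
    have pr: "card (M p \<inter> M r) \<le> 1" using p ne by (intro card_M_Int_le_1) auto
    have qr: "card (M q \<inter> M r) \<le> 1" using p ne by (intro card_M_Int_le_1) auto
    have 1: "card (M p) + card (M q) = card (M p \<union> M q) + card (M p \<inter> M q)"
      by (rule card_Un_Int) auto
    have 2: "card (M p \<union> M q) + card (M r) = card (M p \<union> M q \<union> M r) + card ((M p \<union> M q) \<inter> M r)"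
      by (rule card_Un_Int) auto
    have "card ((M p \<union> M q) \<inter> M r) \<le> card (M p \<inter> M r) + card (M q \<inter> M r)"
      unfolding Int_Un_distrib2 by (rule card_Un_le)
    moreover have "card (M p \<union> M q \<union> M r) \<le> card A"
      using M_subset by (intro card_mono) auto
    ultimately have "card (M p) + card (M q) + card (M r) \<le> card A + 3"
      using 1 2 pq pr qr by linarith
    then show False using large[of p] large[of q] large[of r] p card_A by linarith
  qed
  have "card ?S \<le> 2"
  proof (rule card_le_2_of_no_three)
    fix S1 S2 S3 assume "S1 \<in> ?S" "S2 \<in> ?S" "S3 \<in> ?S"
    then obtain p q r where p: "p \<in> B - H" "q \<in> B - H" "r \<in> B - H" "E d p" "E d q" "E d r"
      and S: "S1 = N p" "S2 = N q" "S3 = N r" by blast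
    have V: "d \<in> V" "p \<in> V" "q \<in> V" "r \<in> V" using d p B_V by blast+
    have "\<not> E p q" "\<not> E p r" "\<not> E q r"
      using triangle_free[of d p q] triangle_free[of d p r] triangle_free[of d q r] p V by blast+
    then show "S1 = S2 \<or> S1 = S3 \<or> S2 = S3" using three p S by blast
  qed simp
  moreover have "card ?T \<le> 2"
  proof (rule card_le_2_of_no_three)
    fix S1 S2 S3 assume "S1 \<in> ?T" "S2 \<in> ?T" "S3 \<in> ?T"
    then obtain p q r where p: "p \<in> B - H" "q \<in> B - H" "r \<in> B - H" "\<not> E d p" "\<not> E d q" "\<not> E d r"
      "N p \<noteq> N d" "N q \<noteq> N d" "N r \<noteq> N d"
      and S: "S1 = N p" "S2 = N q" "S3 = N r" by blast
    show "S1 = S2 \<or> S1 = S3 \<or> S2 = S3"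
    proof (rule ccontr)
      assume ne: "\<not> ?thesis"
      have "E p q" "E p r" "E q r"
        using three[of d p q] three[of d p r] three[of d q r] d p ne S by metis+
      then show False using triangle_free[of p q r] p B_V by blast
    qed
  qed simp
  moreover have "N ` (B - H) \<subseteq> {N d} \<union> ?S \<union> ?T" using d by blast
  then have "card (N ` (B - H)) \<le> card ({N d} \<union> ?S \<union> ?T)" by (intro card_mono) auto
  moreover have "card ({N d} \<union> ?S \<union> ?T) \<le> card {N d} + card ?S + card ?T"
    by (meson add_le_mono1 card_Un_le le_trans)
  ultimately show ?thesis by simp
next
  case True
  then show ?thesis by (simp only: image_empty card.empty)
qed

section \<open>Vertices without neighbours in \<open>A\<close>\<close>

lemma T0_complete_low:
  assumes "t \<in> T0" "d \<in> B - H" "N d \<noteq> {}"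
  shows "E t d"
proof (rule ccontr)
  assume "\<not> E t d"
  then have "card (M t \<inter> M d) \<le> 1"
    using assms by (intro card_M_Int_le_1) (auto simp: T0_def)
  then have "card (M d) \<le> 1" using T0_M[OF assms(1)] M_subset[of d] by (simp add: Int_absorb1)
  then show False using assms(2) card_A by (auto simp: H_def)
qed

lemma N_nonempty_H: "h \<in> H \<Longrightarrow> N h \<noteq> {}"
  using H_common[of h h] in_N by blast

text \<open>Since \<open>t\<close> misses all of \<open>A\<close>, the set \<open>M h\<close> is
  itself the intersection bounded by \<open>card_M_Int_le_1\<close>.\<close>

lemma T0_nonadjacent_H:
  assumes "t \<in> T0" "h \<in> H" "\<not> E t h"
  shows "card (M h) \<le> 1"
proof -
  have "N t = {}" using assms(1) by (simp add: T0_def)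
  then have "N t \<noteq> N h" using N_nonempty_H[OF assms(2)] by simp
  then have "card (M t \<inter> M h) \<le> 1"
    using card_M_Int_le_1 T0_B[OF assms(1)] H_B[OF assms(2)] assms(3) by blast
  then show ?thesis using T0_M[OF assms(1)] M_subset[of h] by (simp add: Int_absorb1)
qed

text \<open>Otherwise a common neighbour \<open>a\<close> of \<open>h\<close> and \<open>e\<close>
  is the centre of a chair with these two as leaves and leg \<open>v\<close>, \<open>x\<close>, and
  \<open>t\<close> sees none of it.\<close>

lemma T0_unique_miss:
  assumes "t \<in> T0" "h \<in> H" "e \<in> H" "\<not> E t h" "\<not> E t e" "x \<in> M h" "x \<in> M e"
  shows "h = e"
proof (rule ccontr)
  assume ne: "h \<noteq> e"
  obtain a where a: "a \<in> A" "E h a" "E e a" using assms(2,3) by (rule H_common)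
  have x: "x \<in> A" "\<not> E h x" "\<not> E e x" using assms(6,7) by (auto simp: in_M)
  have V: "t \<in> V" "h \<in> V" "e \<in> V" "a \<in> V" "x \<in> V"
    using assms(1-3) a x A_V B_V H_B T0_B by auto
  have "E a h" "E a e" using a E_commute[of a] by auto
  moreover have "\<not> E t a" "\<not> E t x" "\<not> E t v" using assms(1) a x T0_A v_B T0_B by auto
  ultimately show False
    using p1_chair_free[of t a h e v x] V vV ne x v_A a(1) assms(4,5) by blast
qed

text \<open>Otherwise \<open>x\<close> is the centre of a chair with leaves \<open>v\<close>,
  \<open>e\<close> and leg \<open>g\<close>, \<open>t\<close>, and \<open>h\<close> sees none of
  it.\<close>

lemma T0_miss_spread:
  assumes "t \<in> T0" "h \<in> H" "e \<in> H" "\<not> E t h" "\<not> E t e" "x \<in> M h" "x \<notin> M e" "g \<in> H" "E t g"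
  shows "x \<in> M g"
proof (rule ccontr)
  assume "x \<notin> M g"
  have x: "x \<in> A" "\<not> E h x" "E x e" "E x g"
    using assms(6,7) \<open>x \<notin> M g\<close> E_commute[of x] by (auto simp: in_M)
  have V: "t \<in> V" "h \<in> V" "e \<in> V" "g \<in> V" "x \<in> V"
    using assms(1-3,8) x A_V B_V H_B T0_B by auto
  have "\<not> E e t" "\<not> E h t" "E g t" using assms(4,5,9) E_commute[of _ t] by auto
  moreover have "\<not> E h e" "\<not> E h g" using assms(2,3,8) H_indep by auto
  moreover have "\<not> E v t" "\<not> E h v" using assms(1,2) v_B H_B T0_B by auto
  moreover have "v \<noteq> e" using assms(3) H_B by (auto simp: B_def)
  ultimately show False
    using p1_chair_free[of h x v e g t] V vV x v_A by blast
qed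

text \<open>Otherwise \<open>h\<close> is the centre of a chair with two leaves in \<open>A\<close>
  and leg \<open>t\<close>, \<open>s\<close>; the only non-neighbour \<open>x\<close> of
  \<open>h\<close> in \<open>A\<close> sees none of it.\<close>

lemma T0_nbr_isolated:
  assumes "t \<in> T0" "s \<in> T0" "h \<in> H" "card (M h) = 1" "E t h"
  shows "\<not> E t s"
proof
  assume "E t s"
  obtain x where x: "M h = {x}" using assms(4) by (auto simp: card_1_singleton_iff)
  have "card (A - {x}) \<ge> 3" using card_A by (auto simp: card_Diff_singleton_if)
  then obtain a b c where "a \<in> A - {x}" "b \<in> A - {x}" "c \<in> A - {x}" "a \<noteq> b"
    by (metis ex_three_of_card_ge_3)
  then have a: "a \<in> A" "b \<in> A" "a \<noteq> b" "E h a" "E h b" using x unfolding M_def by blast+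
  have "x \<in> M h" using x by simp
  then have x': "x \<in> A" "\<not> E x h" using E_commute[of x] by (auto simp: in_M)
  have V: "t \<in> V" "s \<in> V" "h \<in> V" "a \<in> V" "b \<in> V" "x \<in> V"
    using assms(1-3) a x' A_V B_V H_B T0_B by auto
  have "E h t" using assms(5) E_commute by blast
  moreover have "\<not> E a s" "\<not> E b s" "\<not> E x a" "\<not> E x b" "\<not> E x t" "\<not> E x s"
    using assms(1,2) a x' T0_A A_indep by auto
  ultimately show False
    using p1_chair_free[of x h a b t s] V a x' \<open>E t s\<close> by blast
qed

text \<open>\<open>K\<close> collects neighbourhoods in \<open>A\<close> that may be treated as classes of their own: those of the
  vertices outside of \<open>H\<close>, those of their neighbours in \<open>H\<close>, and the neighbourhood of the vertices
  of \<open>H\<close> with a single non-neighbour in \<open>A\<close> if only one such neighbourhood is left.\<close>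

lemma ex_exceptional_family:
  obtains K where "finite K" "card K \<le> 18" "{} \<in> K" "A \<in> K" "N ` (B - H) \<subseteq> K"
    "\<And>h d. h \<in> H \<Longrightarrow> N h \<notin> K \<Longrightarrow> d \<in> B - H \<Longrightarrow> N d \<noteq> {} \<Longrightarrow> \<not> E h d"
    "\<And>h. h \<in> H \<Longrightarrow> N h \<notin> K \<Longrightarrow> card (M h) = 1 \<Longrightarrow>
      \<exists>e\<in>H. N e \<notin> K \<and> card (M e) = 1 \<and> N e \<noteq> N h"
proof -
  define L where "L = N ` (B - H)"
  define rep where "rep S = (SOME s. s \<in> S)" for S :: "'a set"
  have rep: "rep S \<in> S" if "S \<noteq> {}" for S using that by (simp add: rep_def some_in_eq)
  \<comment> \<open>If \<open>h\<close> in \<open>H\<close> sees some \<open>d\<close> with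
    \<open>N d = S\<close>, then \<open>h\<close> misses \<open>rep S\<close> by triangle-freeness,
    so \<open>N h\<close> lies in \<open>F S\<close>. By \<open>card_N_containing\<close> each
    \<open>F S\<close> has at most two members.\<close>
  define F where "F S = N ` {h \<in> H. rep S \<in> M h}" for S
  \<comment> \<open>At most 2 + 5 + 5 * 2 = 17 members; \<open>X\<close> adds at most one.\<close>
  define K0 where "K0 = {{}, A} \<union> L \<union> (\<Union>S\<in>L - {{}}. F S)"
  define H1 where "H1 = {h \<in> H. N h \<notin> K0 \<and> card (M h) = 1}"
  define uniform where "uniform \<longleftrightarrow> (\<forall>h\<in>H1. \<forall>e\<in>H1. N h = N e)"
  define X where "X = (if uniform then N ` H1 else {})"
  define K where "K = K0 \<union> X"
  have finL: "finite L" and cardL: "card L \<le> 5" using card_N_low by (simp_all add: L_def)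
  have finH1: "finite H1" by (simp add: H1_def)
  have cardF: "card (F S) \<le> 2" if "S \<in> L - {{}}" for S
  proof -
    have "rep S \<in> A" using rep[of S] that by (auto simp: L_def N_def)
    then show ?thesis unfolding F_def by (rule card_N_containing)
  qed
  have "card (\<Union>S\<in>L - {{}}. F S) \<le> (\<Sum>S\<in>L - {{}}. card (F S))"
    using finL by (intro card_UN_le) simp
  also have "\<dots> \<le> (\<Sum>S\<in>L - {{}}. 2)" using cardF by (intro sum_mono)
  also have "\<dots> = card (L - {{}}) * 2" by simp
  also have "\<dots> \<le> 10" using card_mono[OF finL, of "L - {{}}"] cardL by auto
  finally have cardU: "card (\<Union>S\<in>L - {{}}. F S) \<le> 10" .
  have "card {{}, A} \<le> 2" by (simp add: card_insert_if)
  then have "card ({{}, A} \<union> L) \<le> 7" using card_Un_le[of "{{}, A}" L] cardL by linarith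
  then have cardK0: "card K0 \<le> 17"
    using card_Un_le[of "{{}, A} \<union> L" "\<Union>S\<in>L - {{}}. F S"] cardU unfolding K0_def by linarith
  have cardX: "card X \<le> 1"
  proof (cases uniform)
    case True
    then have "card (N ` H1) \<le> 1"
      using finH1 unfolding uniform_def by (intro card_le_1_of_no_two) blast+
    then show ?thesis using True by (simp add: X_def)
  qed (simp add: X_def)
  have cardK: "card K \<le> 18"
    using card_Un_le[of K0 X] cardK0 cardX unfolding K_def by linarith
  have "finite X" using finH1 by (simp add: X_def)
  then have finK: "finite K" using finL by (simp add: K_def K0_def F_def)
  show ?thesis
  proof (rule that[OF finK cardK])
    show "{} \<in> K" "A \<in> K" "N ` (B - H) \<subseteq> K" by (auto simp: K_def K0_def L_def)
    show "\<not> E h d" if h: "h \<in> H" "N h \<notin> K" and d: "d \<in> B - H" "N d \<noteq> {}" for h d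
    proof
      assume "E h d"
      have r: "rep (N d) \<in> A" "E d (rep (N d))" using rep[OF d(2)] by (auto simp: in_N)
      have "\<not> E h (rep (N d))"
        using triangle_free[of h d "rep (N d)"] \<open>E h d\<close> r A_V B_V H_B h(1) d(1) by blast
      then have "N h \<in> F (N d)" using h(1) r by (auto simp: F_def in_M)
      moreover have "N d \<in> L - {{}}" using d by (auto simp: L_def)
      ultimately show False using h(2) unfolding K_def K0_def by blast
    qed
    show "\<exists>e\<in>H. N e \<notin> K \<and> card (M e) = 1 \<and> N e \<noteq> N h"
      if h: "h \<in> H" "N h \<notin> K" "card (M h) = 1" for h
    proof -
      have "h \<in> H1" using h by (auto simp: H1_def K_def)
      then have nu: "\<not> uniform" using h(2) by (auto simp: K_def X_def)
      then have "K = K0" by (simp add: K_def X_def)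
      \<comment> \<open>Two members of \<open>H1\<close> have different neighbourhoods, so at least
        one of them differs from \<open>h\<close> in this respect.\<close>
      moreover obtain e where "e \<in> H1" "N e \<noteq> N h" using nu unfolding uniform_def by metis
      ultimately show ?thesis unfolding H1_def by blast
    qed
  qed
qed

end

section \<open>Flipping classes to separate \<open>C\<close> from the rest\<close>

locale exceptional_family = high_degree_vertex +
  fixes K
  assumes finK: "finite K" and card_K: "card K \<le> 18" and empty_K: "{} \<in> K" and A_K: "A \<in> K"
    and low_K: "N ` (B - H) \<subseteq> K"
    and high_low: "h \<in> H \<Longrightarrow> N h \<notin> K \<Longrightarrow> d \<in> B - H \<Longrightarrow> N d \<noteq> {} \<Longrightarrow> \<not> E h d"
    and not_uniform: "h \<in> H \<Longrightarrow> N h \<notin> K \<Longrightarrow> card (M h) = 1 \<Longrightarrow>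
      \<exists>e\<in>H. N e \<notin> K \<and> card (M e) = 1 \<and> N e \<noteq> N h"
begin

definition Hs where "Hs = {h \<in> B. N h \<notin> K}"
definition H1 where "H1 = {h \<in> Hs. card (M h) = 1}"
definition T0a where "T0a = {t \<in> T0. \<forall>h\<in>H1. \<not> E t h}"
text \<open>Vertices of \<open>T0\<close> are sorted into those that see nothing, everything or a
  proper part of \<open>H1\<close>. Choosing \<open>T0c\<close> outside of \<open>T0a\<close> keeps
  the sets disjoint when \<open>H1\<close> is empty.\<close>

definition T0c where "T0c = {t \<in> T0 - T0a. \<forall>h\<in>H1. E t h}"
definition T0b where "T0b = T0 - T0a - T0c"
definition D where "D = B - Hs - T0"
definition C where "C = T0a \<union> T0c \<union> D"

lemma Hs_H: "h \<in> Hs \<Longrightarrow> h \<in> H"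
  using low_K by (auto simp: Hs_def)

lemma Hs_T0: "h \<in> Hs \<Longrightarrow> h \<notin> T0"
  using empty_K by (auto simp: Hs_def T0_def)

text \<open>If \<open>t\<close> missed a second member of \<open>H\<close>, then
  \<open>T0_miss_spread\<close> would apply to \<open>h\<close> and to the counterpart
  \<open>e'\<close> from \<open>not_uniform\<close>, and the neighbour \<open>g\<close> of
  \<open>t\<close> in \<open>H1\<close> would miss two vertices of \<open>A\<close>. The same
  \<open>g\<close> keeps \<open>t\<close> from seeing \<open>T0\<close>, by
  \<open>T0_nbr_isolated\<close>.\<close>

lemma T0b_miss:
  assumes "t \<in> T0b"
  shows "\<exists>h\<in>H1. (\<forall>e\<in>H. e \<noteq> h \<longrightarrow> E t e) \<and> (\<forall>s\<in>T0. \<not> E t s)"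
proof -
  have t: "t \<in> T0" using assms by (simp add: T0b_def)
  obtain g h where g: "g \<in> H1" "E t g" and h: "h \<in> H1" "\<not> E t h"
    using assms by (auto simp: T0a_def T0b_def T0c_def)
  have gH: "g \<in> H" "card (M g) = 1" and hH: "h \<in> H" "card (M h) = 1" "N h \<notin> K"
    using g(1) h(1) Hs_H by (auto simp: H1_def Hs_def)
  obtain x where x: "M h = {x}" using hH(2) by (auto simp: card_1_singleton_iff)
  have "E t e" if e: "e \<in> H" "e \<noteq> h" for e
  proof (rule ccontr)
    assume ne: "\<not> E t e"
    have "x \<notin> M e" using T0_unique_miss[OF t hH(1) e(1) h(2) ne, of x] x e(2) by auto
    then have spread: "x \<in> M f" if "f \<in> H" "E t f" for f
      using T0_miss_spread[OF t hH(1) e(1) h(2) ne, of x f] x that by simp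
    obtain e' where e': "e' \<in> H" "card (M e') = 1" "N e' \<noteq> N h" using not_uniform hH by blast
    obtain x' where x': "M e' = {x'}" using e'(2) by (auto simp: card_1_singleton_iff)
    have "x' \<noteq> x" using e'(3) x x' M_eq_iff[of e' h] by auto
    then have ne': "\<not> E t e'" using spread[of e'] e'(1) x' by auto
    have "x' \<in> M g"
      using T0_miss_spread[OF t e'(1) hH(1) ne' h(2), of x' g] x x' \<open>x' \<noteq> x\<close> gH(1) g(2) by simp
    moreover have "x \<in> M g" using spread gH(1) g(2) by blast
    ultimately show False
      using gH(2) \<open>x' \<noteq> x\<close> by (auto simp: card_1_singleton_iff)
  qed
  moreover have "\<not> E t s" if "s \<in> T0" for s
    using T0_nbr_isolated[OF t that gH] g(2) by blast
  ultimately show ?thesis using h(1) by blast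
qed

lemma V_parts: "w \<in> V \<Longrightarrow> w = v \<or> w \<in> A \<or> w \<in> Hs \<or> w \<in> T0b \<or> w \<in> C"
  by (auto simp: B_def C_def D_def T0b_def)

lemma parts_disjoint:
  "w \<in> A \<Longrightarrow> w \<noteq> v \<and> w \<notin> Hs \<and> w \<notin> T0b \<and> w \<notin> C"
  "w \<in> Hs \<Longrightarrow> w \<noteq> v \<and> w \<notin> A \<and> w \<notin> T0b \<and> w \<notin> C"
  "w \<in> T0b \<Longrightarrow> w \<noteq> v \<and> w \<notin> A \<and> w \<notin> Hs \<and> w \<notin> C"
  "w \<in> C \<Longrightarrow> w \<noteq> v \<and> w \<notin> A \<and> w \<notin> Hs \<and> w \<notin> T0b"
  using Hs_T0[of w] irrE[of v]
  by (auto simp: A_def B_def C_def D_def T0_def Hs_def T0a_def T0b_def T0c_def)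

lemma v_parts: "v \<notin> A" "v \<notin> Hs" "v \<notin> T0b" "v \<notin> C"
  using parts_disjoint[of v] by blast+

lemma Hs_indep: "h \<in> Hs \<Longrightarrow> e \<in> Hs \<Longrightarrow> \<not> E h e"
  using H_indep Hs_H by blast

lemma Hs_D:
  assumes "h \<in> Hs" "d \<in> D"
  shows "\<not> E h d"
proof (cases "d \<in> H")
  case True
  then show ?thesis using assms Hs_H H_indep by blast
next
  case False
  then show ?thesis
    using high_low[of h d] assms Hs_H[of h] by (auto simp: D_def Hs_def T0_def)
qed

text \<open>A non-adjacent \<open>h\<close> misses at most one vertex of \<open>A\<close>. Missing
  exactly one is excluded by \<open>h \<notin> H1\<close>, missing none by
  \<open>A \<in> K\<close>.\<close>

lemma Hs_T0_adjacent:
  assumes "h \<in> Hs" "h \<notin> H1" "t \<in> T0"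
  shows "E t h"
proof (rule ccontr)
  assume "\<not> E t h"
  then have "card (M h) \<le> 1" using assms Hs_H by (intro T0_nonadjacent_H)
  moreover have "card (M h) \<noteq> 1" using assms by (simp add: H1_def)
  ultimately have "card (M h) = 0" by linarith
  then have "M h = {}" by simp
  then have "N h = A" by (auto simp: M_def N_def)
  then show False using assms A_K by (simp add: Hs_def)
qed

lemma T0b_D:
  assumes "t \<in> T0b" "d \<in> D"
  shows "E t d"
proof (cases "d \<in> H")
  case True
  obtain h where h: "h \<in> H1" "\<And>e. e \<in> H \<Longrightarrow> e \<noteq> h \<Longrightarrow> E t e"
    using T0b_miss[OF assms(1)] by blast
  have "d \<noteq> h" using h(1) assms(2) by (auto simp: D_def H1_def)
  then show ?thesis using h(2) True by blast
next
  case False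
  then show ?thesis using T0_complete_low[of t d] assms by (auto simp: D_def T0b_def T0_def)
qed

lemma T0b_anticomplete: "t \<in> T0b \<Longrightarrow> s \<in> T0 \<Longrightarrow> \<not> E t s"
  using T0b_miss by blast

text \<open>The flipped graph is chosen so that \<open>C\<close> is separated from the rest,
  \<open>v\<close> is isolated, each vertex of \<open>T0b\<close> has at most one neighbour, and the
  sets \<open>M h\<close> describe the edges between \<open>Hs\<close> and \<open>A\<close>.\<close>

definition Ef where
  "Ef u w \<longleftrightarrow> (u \<in> C \<and> w \<in> C \<and> E u w) \<or>
     (\<not> E u w \<and> (u \<in> Hs \<and> w \<in> A \<union> T0b \<or> w \<in> Hs \<and> u \<in> A \<union> T0b))"

lemma sym_Ef: "symp Ef"
  using E_commute by (auto simp: Ef_def symp_def)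

text \<open>Since \<open>v\<close> sees nothing of \<open>C\<close>, a chair inside \<open>C\<close>
  would form the forbidden graph together with \<open>v\<close>.\<close>

lemma width_le_C: "width_le C Ef 16"
proof -
  have CB: "C \<subseteq> B" by (auto simp: C_def D_def T0a_def T0c_def T0_def)
  have CV: "C \<subseteq> V" using CB B_V by blast
  interpret C: triangle_free_graph C E by (rule triangle_free_subset[OF CV])
  have "width_le C E 16"
  proof (rule C.width_le_chair_free, rule ccontr)
    fix x a b c d
    assume *: "x \<in> C" "a \<in> C" "b \<in> C" "c \<in> C" "d \<in> C" "E x a" "E x b" "E x c" "E c d"
      "\<not> E a d" "\<not> E b d" "a \<noteq> b"
    then have "\<not> E v x" "\<not> E v a" "\<not> E v b" "\<not> E v c" "\<not> E v d" using CB v_B by blast+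
    then show False using p1_chair_free[of v x a b c d] * CV vV by blast
  qed
  then show ?thesis
  proof (rule width_le_cong)
    fix u w assume "u \<in> C" "w \<in> C"
    then show "E u w = Ef u w" using parts_disjoint(4)[of u] parts_disjoint(4)[of w] by (auto simp: Ef_def)
  qed
qed

text \<open>In an induced subgraph with several vertices, none of them attachable, all degrees are
  at least 2, which excludes \<open>v\<close> and \<open>T0b\<close>, and \<open>Hs\<close> contains
  no twins. The sets \<open>M h\<close> then yield maximum degree 2.\<close>

lemma width_le_rest: "width_le (V - C) Ef 8"
proof (rule width_le_reducible[OF _ sym_Ef])
  show "finite (V - C)" using finV by simp
  fix U assume U: "U \<subseteq> V - C" "U \<noteq> {}"
  have finU: "finite U" using U finV finite_subset by blast
  show "(\<exists>t. attachable U Ef t) \<or> width_le U Ef 8"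
  proof (cases "(\<exists>t. attachable U Ef t) \<or> (\<exists>t. U = {t})")
    case True
    then show ?thesis using width_le_singleton[of 8 _ Ef] by auto
  next
    case False
    have deg: "2 \<le> card {w \<in> U. Ef u w}" if "u \<in> U" for u
    proof (rule ccontr)
      assume "\<not> ?thesis"
      then have "card {w \<in> U. Ef u w} \<le> 1" by linarith
      then show False using attachable_degree_le_1[of u U Ef] that finU False by blast
    qed
    have "v \<notin> U"
    proof
      assume "v \<in> U"
      moreover have "{w \<in> U. Ef v w} = {}"
        using v_parts by (simp add: Ef_def)
      ultimately show False using deg[of v] by (metis card.empty not_numeral_le_zero)
    qed
    moreover have "t \<notin> T0b" if "t \<in> U" for t
    proof
      assume t: "t \<in> T0b"
      obtain h where h: "h \<in> H1" "\<And>e. e \<in> H \<Longrightarrow> e \<noteq> h \<Longrightarrow> E t e"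
        using T0b_miss[OF t] by blast
      have "w = h" if "Ef t w" for w
        using that h(2)[of w] Hs_H[of w] parts_disjoint(3)[OF t] by (auto simp: Ef_def)
      then have "{w \<in> U. Ef t w} \<subseteq> {h}" by blast
      then have "card {w \<in> U. Ef t w} \<le> 1" using card_mono[of "{h}"] by fastforce
      then show False using deg[OF \<open>t \<in> U\<close>] by simp
    qed
    ultimately have parts: "u \<in> A \<or> u \<in> Hs" if "u \<in> U" for u
      using that V_parts[of u] U by blast
    have Ef_Hs: "Ef h w \<longleftrightarrow> w \<in> M h" if "h \<in> Hs" "w \<in> U" for h w
      using parts[OF that(2)] parts_disjoint(1)[of w] parts_disjoint(2)[of w] parts_disjoint(2)[OF that(1)] that(1)
      by (auto simp: Ef_def in_M)
    have Ef_A: "Ef a w \<longleftrightarrow> w \<in> Hs \<and> a \<in> M w" if "a \<in> A" "w \<in> U" for a w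
      using parts[OF that(2)] parts_disjoint(1)[OF that(1)] that(1) E_commute[of a w]
      by (auto simp: Ef_def in_M)
    have no_twins: "h = e" if he: "h \<in> U \<inter> Hs" "e \<in> U \<inter> Hs" "N h = N e" for h e
    proof (rule ccontr)
      assume "h \<noteq> e"
      have "M h = M e" using he(3) M_eq_iff by blast
      then have "\<forall>w\<in>U - {h, e}. Ef h w \<longleftrightarrow> Ef e w" using Ef_Hs he by auto
      then have "attachable U Ef h" using he \<open>h \<noteq> e\<close> by (auto simp: attachable_def)
      then show False using False by blast
    qed
    have "card {w \<in> U. Ef u w} \<le> 2" if u: "u \<in> U" for u
    proof (cases "u \<in> A")
      case True
      let ?S = "{h \<in> U \<inter> Hs. u \<in> M h}"
      have "{w \<in> U. Ef u w} = ?S" using Ef_A[OF True] by auto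
      moreover have "inj_on N ?S" using no_twins by (auto intro: inj_onI)
      then have "card ?S = card (N ` ?S)" by (simp add: card_image)
      moreover have "card (N ` ?S) \<le> card (N ` {h \<in> H. u \<in> M h})"
        using Hs_H by (intro card_mono) auto
      ultimately show ?thesis using card_N_containing[OF True] by simp
    next
      case False
      then have uHs: "u \<in> Hs" using parts u by blast
      have "{w \<in> U. Ef u w} \<noteq> {}" using deg[OF u] by (metis card.empty not_numeral_le_zero)
      then obtain a where a: "a \<in> U" "a \<in> M u" using Ef_Hs[OF uHs] by blast
      have aA: "a \<in> A" using a by (simp add: in_M)
      \<comment> \<open>The degree of \<open>a\<close> is at least 2, so a second vertex
        \<open>e\<close> of \<open>Hs\<close> misses \<open>a\<close>. As twins are gone,
        \<open>H_meet_card_M\<close> applies to \<open>e\<close> and \<open>u\<close>.\<close>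
      have "\<exists>e\<in>{w \<in> U. Ef a w}. e \<noteq> u"
      proof (rule ccontr)
        assume "\<not> ?thesis"
        then have "{w \<in> U. Ef a w} \<subseteq> {u}" by blast
        then have "card {w \<in> U. Ef a w} \<le> 1" using card_mono[of "{u}"] by fastforce
        then show False using deg[OF a(1)] by simp
      qed
      then obtain e where e: "e \<in> U" "e \<in> Hs" "a \<in> M e" "e \<noteq> u" using Ef_A[OF aA] by blast
      then have "N e \<noteq> N u" using no_twins[of e u] u uHs by blast
      then have "card (M u) \<le> 2" using H_meet_card_M[of e u a] e a uHs Hs_H by blast
      moreover have "card {w \<in> U. Ef u w} \<le> card (M u)"
        using Ef_Hs[OF uHs] by (intro card_mono) auto
      ultimately show ?thesis by linarith
    qed
    then show ?thesis using width_le_degree_le_2[OF finU sym_Ef] by blast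
  qed
qed simp

text \<open>For fixed \<open>w\<close>, the right-hand sides depend only on the class of \<open>x\<close>, so that \<open>E\<close> and \<open>Ef\<close> differ by
  a flip of classes.\<close>

lemma flip_cases:
  assumes "x \<in> V" "w \<in> V" "w \<noteq> x"
  shows "w = v \<Longrightarrow> (E x w \<longleftrightarrow> Ef x w) \<longleftrightarrow> x \<notin> A"
    and "w \<in> A \<Longrightarrow> (E x w \<longleftrightarrow> Ef x w) \<longleftrightarrow> x \<noteq> v \<and> x \<notin> Hs \<and> (x \<in> D \<longrightarrow> w \<notin> N x)"
    and "w \<in> Hs \<Longrightarrow> (E x w \<longleftrightarrow> Ef x w) \<longleftrightarrow> x = v \<or> x \<in> Hs \<or> x \<in> D \<or> x \<in> T0a \<and> w \<in> H1"
    and "w \<in> T0b \<Longrightarrow> (E x w \<longleftrightarrow> Ef x w) \<longleftrightarrow> x \<notin> Hs \<and> x \<notin> D"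
    and "w \<in> C \<Longrightarrow> (E x w \<longleftrightarrow> Ef x w) \<longleftrightarrow> x \<in> C \<or> x = v \<or> x \<in> A \<and> x \<notin> N w \<or>
      x \<in> Hs \<and> (w \<in> D \<or> w \<in> T0a \<and> x \<in> H1) \<or> x \<in> T0b \<and> w \<in> T0"
proof -
  have E_T0: "E t a \<longleftrightarrow> False" "E a t \<longleftrightarrow> False" if "t \<in> T0" "a \<in> A" for t a
    using T0_A that by blast+
  have D_C: "d \<in> C" "d \<notin> T0" if "d \<in> D" for d using that by (auto simp: C_def D_def)
  have C_T0: "u \<in> D \<or> u \<in> T0a \<or> u \<in> T0c" "u \<in> D \<or> u \<in> T0" if "u \<in> C" for u
    using that by (auto simp: C_def T0a_def T0c_def)
  have C_B: "u \<in> B" if "u \<in> C" for u using that by (auto simp: C_def D_def T0a_def T0c_def T0_def)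
  have T0b_T0: "u \<in> T0" if "u \<in> T0b" for u using that by (simp add: T0b_def)
  have T0b_B: "u \<in> B" if "u \<in> T0b" for u using T0b_T0[OF that] T0_B by blast
  have Hs_B: "u \<in> B" if "u \<in> Hs" for u using that by (simp add: Hs_def)
  have Hs_nT0: "E u h \<longleftrightarrow> \<not> (u \<in> D \<or> u \<in> T0a \<and> h \<in> H1)" "E h u \<longleftrightarrow> \<not> (u \<in> D \<or> u \<in> T0a \<and> h \<in> H1)"
    if uh: "u \<in> C" "h \<in> Hs" for u h
  proof -
    show "E u h \<longleftrightarrow> \<not> (u \<in> D \<or> u \<in> T0a \<and> h \<in> H1)"
    proof (cases "u \<in> D")
      case True
      then show ?thesis using Hs_D[OF uh(2)] E_commute[of u h] by blast
    next
      case False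
      then have "u \<in> T0" using C_T0(2)[OF uh(1)] by blast
      then have "E u h" if "h \<notin> H1" using Hs_T0_adjacent uh that by blast
      moreover have "u \<in> T0a \<or> u \<in> T0c" using C_T0(1)[OF uh(1)] False by blast
      ultimately show ?thesis using False unfolding T0a_def T0c_def by blast
    qed
    then show "E h u \<longleftrightarrow> \<not> (u \<in> D \<or> u \<in> T0a \<and> h \<in> H1)" using E_commute[of u h] by blast
  qed
  have T0b_C: "E t u \<longleftrightarrow> u \<in> D" "E u t \<longleftrightarrow> u \<in> D" if tu: "t \<in> T0b" "u \<in> C" for t u
  proof -
    show "E t u \<longleftrightarrow> u \<in> D" using C_T0(2)[OF tu(2)] T0b_D T0b_anticomplete tu by blast
    then show "E u t \<longleftrightarrow> u \<in> D" using E_commute[of u t] by blast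
  qed
  have A_C: "E a u \<longleftrightarrow> a \<in> N u" "E u a \<longleftrightarrow> a \<in> N u" if "a \<in> A" for a u
    using that E_commute[of a u] by (auto simp: in_N)
  have N_T0: "N u = {}" if "u \<in> T0" for u using that by (simp add: T0_def)
  consider "x = v" | "x \<in> A" | "x \<in> Hs" | "x \<in> T0b" | "x \<in> C" using V_parts[OF assms(1)] by blast
  note x_cases = this
  show "(E x w \<longleftrightarrow> Ef x w) \<longleftrightarrow> x \<notin> A" if "w = v"
  proof -
    have "\<not> Ef x v" using v_parts by (simp add: Ef_def)
    moreover have "E x v \<longleftrightarrow> x \<in> A" using assms(1) E_commute[of x v] by (simp add: A_def)
    ultimately show ?thesis using that by blast
  qed
  show "(E x w \<longleftrightarrow> Ef x w) \<longleftrightarrow> x \<noteq> v \<and> x \<notin> Hs \<and> (x \<in> D \<longrightarrow> w \<notin> N x)" if w: "w \<in> A"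
    using x_cases
  proof cases
    case 1
    then show ?thesis using v_A(1)[OF w] v_parts by (simp add: Ef_def)
  next
    case 2
    then show ?thesis
      using A_indep[OF 2 w] parts_disjoint(1)[OF 2] parts_disjoint(1)[OF w] D_C by (auto simp: Ef_def)
  next
    case 3
    then show ?thesis using parts_disjoint(2)[OF 3] w by (simp add: Ef_def)
  next
    case 4
    then show ?thesis
      using parts_disjoint(3)[OF 4] parts_disjoint(1)[OF w] E_T0(1)[OF T0b_T0[OF 4] w] D_C
      by (auto simp: Ef_def)
  next
    case 5
    then show ?thesis
      using parts_disjoint(4)[OF 5] parts_disjoint(1)[OF w] C_T0(2)[OF 5] N_T0[of x] A_C(2)[OF w, of x]
      by (auto simp: Ef_def)
  qed
  show "(E x w \<longleftrightarrow> Ef x w) \<longleftrightarrow> x = v \<or> x \<in> Hs \<or> x \<in> D \<or> x \<in> T0a \<and> w \<in> H1" if w: "w \<in> Hs"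
    using x_cases
  proof cases
    case 1
    then show ?thesis using v_B(1)[OF Hs_B[OF w]] v_parts by (simp add: Ef_def)
  next
    case 2
    then have "x \<notin> T0a" using parts_disjoint(1)[OF 2] by (auto simp: C_def)
    then show ?thesis using parts_disjoint(1)[OF 2] w 2 D_C by (auto simp: Ef_def)
  next
    case 3
    then show ?thesis
      using Hs_indep[OF 3 w] parts_disjoint(2)[OF 3] parts_disjoint(2)[OF w] by (simp add: Ef_def)
  next
    case 4
    then have "x \<notin> T0a" using parts_disjoint(3)[OF 4] by (auto simp: C_def)
    then show ?thesis using parts_disjoint(3)[OF 4] w 4 D_C by (auto simp: Ef_def)
  next
    case 5
    then have "\<not> Ef x w" using parts_disjoint(4)[OF 5] parts_disjoint(2)[OF w] by (simp add: Ef_def)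
    then show ?thesis using Hs_nT0(1)[OF 5 w] parts_disjoint(4)[OF 5] by blast
  qed
  show "(E x w \<longleftrightarrow> Ef x w) \<longleftrightarrow> x \<notin> Hs \<and> x \<notin> D" if w: "w \<in> T0b"
    using x_cases
  proof cases
    case 1
    then show ?thesis using v_B(1)[OF T0b_B[OF w]] v_parts D_C by (auto simp: Ef_def)
  next
    case 2
    then show ?thesis
      using E_T0(2)[OF T0b_T0[OF w] 2] parts_disjoint(1)[OF 2] parts_disjoint(3)[OF w] D_C
      by (auto simp: Ef_def)
  next
    case 3
    then show ?thesis using parts_disjoint(2)[OF 3] w by (simp add: Ef_def)
  next
    case 4
    have "\<not> E x w" using T0b_anticomplete[OF 4 T0b_T0[OF w]] .
    then show ?thesis
      using parts_disjoint(3)[OF 4] parts_disjoint(3)[OF w] D_C by (auto simp: Ef_def)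
  next
    case 5
    then show ?thesis
      using T0b_C(2)[OF w 5] parts_disjoint(4)[OF 5] parts_disjoint(3)[OF w] by (simp add: Ef_def)
  qed
  show "(E x w \<longleftrightarrow> Ef x w) \<longleftrightarrow> x \<in> C \<or> x = v \<or> x \<in> A \<and> x \<notin> N w \<or>
      x \<in> Hs \<and> (w \<in> D \<or> w \<in> T0a \<and> x \<in> H1) \<or> x \<in> T0b \<and> w \<in> T0" if w: "w \<in> C"
    using x_cases
  proof cases
    case 1
    then show ?thesis using v_B(1)[OF C_B[OF w]] v_parts by (simp add: Ef_def)
  next
    case 2
    then show ?thesis
      using A_C(1)[OF 2, of w] parts_disjoint(1)[OF 2] parts_disjoint(4)[OF w] by (simp add: Ef_def)
  next
    case 3
    then have "\<not> Ef x w" using parts_disjoint(2)[OF 3] parts_disjoint(4)[OF w] by (simp add: Ef_def)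
    then show ?thesis using Hs_nT0(2)[OF w 3] parts_disjoint(2)[OF 3] 3 by blast
  next
    case 4
    then have "\<not> Ef x w" using parts_disjoint(3)[OF 4] parts_disjoint(4)[OF w] by (simp add: Ef_def)
    then show ?thesis
      using T0b_C(1)[OF 4 w] parts_disjoint(3)[OF 4] 4 C_T0(2)[OF w] D_C(2)[of w] by blast
  next
    case 5
    then show ?thesis using parts_disjoint(4)[OF 5] parts_disjoint(4)[OF w] w by (simp add: Ef_def)
  qed
qed

lemma width_le_exceptional: "width_le V E (256 * (2 ^ 18 * 18) * (16 + 1))"
proof -
  have "width_le (C \<union> (V - C)) Ef 16"
  proof (rule width_le_disjoint_union[OF width_le_C])
    show "width_le (V - C) Ef 16" by (rule width_le_mono[OF width_le_rest]) simp
    fix u w assume "u \<in> C" "w \<in> V - C"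
    then show "\<not> Ef u w \<and> \<not> Ef w u" using parts_disjoint(4)[of u] by (auto simp: Ef_def)
  qed simp
  moreover have "C \<subseteq> V" using B_V by (auto simp: C_def D_def T0a_def T0c_def T0_def)
  ultimately have wd: "width_le V Ef 16" by (simp add: Un_absorb1)
  \<comment> \<open>For \<open>w\<close> in \<open>C\<close> the set \<open>N w\<close> belongs to
    \<open>K\<close>, so the second component decides which \<open>u\<close> in \<open>A\<close> are
    adjacent to \<open>w\<close>. For \<open>u\<close> in \<open>D\<close> the third one determines
    the neighbours in \<open>A\<close>; elsewhere it takes the default \<open>{}\<close>, a member
    of \<open>K\<close>. This makes at most 2 ^ 8 * 2 ^ 18 * 18 classes.\<close>
  define c where "c u = ((u = v, u \<in> A, u \<in> Hs, u \<in> H1, u \<in> T0a, u \<in> T0b, u \<in> C, u \<in> D),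
    {k \<in> K. u \<in> k}, if u \<in> D then N u else {})" for u
  let ?B = "{True, False}"
  let ?S = "(?B \<times> ?B \<times> ?B \<times> ?B \<times> ?B \<times> ?B \<times> ?B \<times> ?B) \<times> Pow K \<times> K"
  have sub: "c ` V \<subseteq> ?S"
  proof (rule image_subsetI)
    fix u
    have "(if u \<in> D then N u else {}) \<in> K" using empty_K by (simp add: D_def Hs_def)
    then show "c u \<in> ?S" unfolding c_def by blast
  qed
  have "card (c ` V) \<le> card ?S" using finK by (intro card_mono[OF _ sub]) simp
  also have "card ?S = 256 * (2 ^ card K * card K)"
    using finK by (simp add: card_cartesian_product card_Pow)
  also have "\<dots> \<le> 256 * (2 ^ 18 * 18)"
    using card_K by (intro mult_le_mono power_increasing) auto
  finally have card_c: "card (c ` V) \<le> 256 * (2 ^ 18 * 18)" .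
  show ?thesis
  proof (rule width_le_flip[OF wd finite_imageI[OF finV] card_c])
    fix x y w assume xyw: "x \<in> V" "y \<in> V" "w \<in> V" "c x = c y" "w \<noteq> x" "w \<noteq> y"
    have same: "x = v \<longleftrightarrow> y = v" "x \<in> A \<longleftrightarrow> y \<in> A" "x \<in> Hs \<longleftrightarrow> y \<in> Hs" "x \<in> H1 \<longleftrightarrow> y \<in> H1"
      "x \<in> T0a \<longleftrightarrow> y \<in> T0a" "x \<in> T0b \<longleftrightarrow> y \<in> T0b" "x \<in> C \<longleftrightarrow> y \<in> C" "x \<in> D \<longleftrightarrow> y \<in> D"
      and sameK: "{k \<in> K. x \<in> k} = {k \<in> K. y \<in> k}"
      and "(if x \<in> D then N x else {}) = (if y \<in> D then N y else {})"
      using xyw(4) unfolding c_def prod.inject by blast+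
    then have sameN: "x \<in> D \<Longrightarrow> N x = N y" by simp
    note fx = flip_cases[OF xyw(1,3,5)] and fy = flip_cases[OF xyw(2,3,6)]
    consider "w = v" | "w \<in> A" | "w \<in> Hs" | "w \<in> T0b" | "w \<in> C" using V_parts[OF xyw(3)] by blast
    then show "(E x w \<longleftrightarrow> Ef x w) \<longleftrightarrow> (E y w \<longleftrightarrow> Ef y w)"
    proof cases
      case 1
      show ?thesis unfolding fx(1)[OF 1] fy(1)[OF 1] using same by blast
    next
      case 2
      show ?thesis unfolding fx(2)[OF 2] fy(2)[OF 2] using same sameN by blast
    next
      case 3
      show ?thesis unfolding fx(3)[OF 3] fy(3)[OF 3] using same by blast
    next
      case 4
      show ?thesis unfolding fx(4)[OF 4] fy(4)[OF 4] using same by blast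
    next
      case 5
      have "N w \<in> K" using 5 parts_disjoint(4)[OF 5] empty_K
        by (auto simp: C_def D_def Hs_def T0a_def T0c_def T0_def)
      then have "x \<in> N w \<longleftrightarrow> y \<in> N w" using sameK by blast
      then show ?thesis unfolding fx(5)[OF 5] fy(5)[OF 5] using same by blast
    qed
  qed
qed

end

lemma (in high_degree_vertex) width_le_high_degree: "width_le V E (256 * (2 ^ 18 * 18) * (16 + 1))"
proof -
  obtain K where "exceptional_family V E v K"
  proof (rule ex_exceptional_family)
    fix K
    assume "finite K" "card K \<le> 18" "{} \<in> K" "A \<in> K" "N ` (B - H) \<subseteq> K"
      "\<And>h d. h \<in> H \<Longrightarrow> N h \<notin> K \<Longrightarrow> d \<in> B - H \<Longrightarrow> N d \<noteq> {} \<Longrightarrow> \<not> E h d"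
      "\<And>h. h \<in> H \<Longrightarrow> N h \<notin> K \<Longrightarrow> card (M h) = 1 \<Longrightarrow>
        \<exists>e\<in>H. N e \<notin> K \<and> card (M e) = 1 \<and> N e \<noteq> N h"
    then have "exceptional_family V E v K" by unfold_locales
    then show ?thesis by (rule that)
  qed
  then show ?thesis by (rule exceptional_family.width_le_exceptional)
qed

lemma (in p1_chair_free_graph) width_le_triangle_free:
  "width_le V E (256 * (2 ^ 18 * 18) * (16 + 1))"
proof (cases "\<exists>v\<in>V. 7 \<le> card {w \<in> V. E v w}")
  case True
  then obtain v where "v \<in> V" "7 \<le> card {w \<in> V. E v w}" by blast
  then have "high_degree_vertex V E v" by unfold_locales
  then show ?thesis by (rule high_degree_vertex.width_le_high_degree)
next
  case low: False
  show ?thesis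
  proof (cases "\<exists>x\<in>V. \<exists>a\<in>V. \<exists>b\<in>V. \<exists>c\<in>V. \<exists>d\<in>V.
      E x a \<and> E x b \<and> E x c \<and> E c d \<and> \<not> E a d \<and> \<not> E b d \<and> a \<noteq> b")
    case True
    then obtain x a b c d where V: "x \<in> V" "a \<in> V" "b \<in> V" "c \<in> V" "d \<in> V"
      and chair: "E x a" "E x b" "E x c" "E c d" "\<not> E a d" "\<not> E b d" "a \<noteq> b" by blast
    let ?S = "{x, a, b, c, d}"
    \<comment> \<open>A vertex without a neighbour on the chair would form the forbidden graph with
      it. The vertices of the chair have neighbours on it themselves, so five neighbourhoods cover
      \<open>V\<close>.\<close>
    have cover: "V \<subseteq> (\<Union>s\<in>?S. {w \<in> V. E s w})"
    proof
      fix z assume z: "z \<in> V"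
      then have "E z x \<or> E z a \<or> E z b \<or> E z c \<or> E z d"
        using p1_chair_free[of z x a b c d] V chair by blast
      then show "z \<in> (\<Union>s\<in>?S. {w \<in> V. E s w})" using z E_commute[of z] by auto
    qed
    have "card V \<le> card (\<Union>s\<in>?S. {w \<in> V. E s w})" using finV by (intro card_mono[OF _ cover]) auto
    also have "\<dots> \<le> (\<Sum>s\<in>?S. card {w \<in> V. E s w})" by (intro card_UN_le) simp
    also have "\<dots> \<le> (\<Sum>s\<in>?S. 7)"
    proof (rule sum_mono)
      fix s assume "s \<in> ?S"
      then have "s \<in> V" using V by blast
      then show "card {w \<in> V. E s w} \<le> 7" using low nat_le_linear by blast
    qed
    also have "\<dots> = card ?S * 7" by simp
    also have "\<dots> \<le> 5 * 7" using card_length[of "[x, a, b, c, d]"] by (intro mult_le_mono) auto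
    finally have "card V \<le> 35" by simp
    then have "width_le V E 35" using finV by (intro width_le_card)
    then show ?thesis by (rule width_le_mono) simp
  next
    case False
    have "width_le V E 16" by (rule width_le_chair_free) (use False in blast)
    then show ?thesis by (rule width_le_mono) simp
  qed
qed

section \<open>Paw-free graphs\<close>

text \<open>Non-adjacent vertices are false twins, and in a complete graph any two vertices are true
  twins, so an attachable vertex exists until a single vertex is left.\<close>

lemma width_le_nonadjacency_transitive:
  assumes "finite V" "symp E"
    and trans: "\<And>x y z. x \<in> V \<Longrightarrow> y \<in> V \<Longrightarrow> z \<in> V \<Longrightarrow> x \<noteq> y \<Longrightarrow> y \<noteq> z \<Longrightarrow>
      \<not> E x y \<Longrightarrow> \<not> E y z \<Longrightarrow> \<not> E x z"
  shows "width_le V E 1"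
proof (rule width_le_reducible[OF assms(1,2)])
  fix U assume U: "U \<subseteq> V" "U \<noteq> {}"
  have sym: "E x y \<longleftrightarrow> E y x" for x y using assms(2) by (metis sympD)
  show "(\<exists>t. attachable U E t) \<or> width_le U E 1"
  proof (cases "\<exists>u\<in>U. \<exists>w\<in>U. u \<noteq> w \<and> \<not> E u w")
    case True
    then obtain u w where uw: "u \<in> U" "w \<in> U" "u \<noteq> w" "\<not> E u w" by blast
    have "E u t \<longleftrightarrow> E w t" if "t \<in> U - {u, w}" for t
      using trans[of u w t] trans[of w u t] sym[of u w] uw that U by blast
    then have "attachable U E u" using uw by (auto simp: attachable_def)
    then show ?thesis by blast
  next
    case False
    then have complete: "E a b" if "a \<in> U" "b \<in> U" "a \<noteq> b" for a b using that by blast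
    obtain u where u: "u \<in> U" using U by blast
    show ?thesis
    proof (cases "U = {u}")
      case False
      then obtain w where w: "w \<in> U" "w \<noteq> u" using u by blast
      have "E u t \<longleftrightarrow> E w t" if "t \<in> U - {u, w}" for t
        using complete[of u t] complete[of w t] that u w by auto
      then have "attachable U E u" using u w by (auto simp: attachable_def)
      then show ?thesis by blast
    qed (simp add: width_le_singleton)
  qed
qed simp

text \<open>This is Olariu's theorem: non-adjacency is transitive in complete multipartite graphs.\<close>

lemma paw_free_nonadjacency_transitive:
  assumes sym: "symp E" and conn: "conn_graph V E"
    and paw_free: "\<And>p a b q. p \<in> V \<Longrightarrow> a \<in> V \<Longrightarrow> b \<in> V \<Longrightarrow> q \<in> V \<Longrightarrow>
      E p a \<Longrightarrow> E p b \<Longrightarrow> E a b \<Longrightarrow> E p q \<Longrightarrow> E q a \<or> E q b"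
    and tri: "s \<in> V" "t \<in> V" "r \<in> V" "E s t" "E s r" "E t r"
    and xyz: "x \<in> V" "y \<in> V" "z \<in> V" "\<not> E x y" "\<not> E y z"
  shows "\<not> E x z"
proof
  assume "E x z"
  have comm: "E u w \<longleftrightarrow> E w u" for u w using sym by (metis sympD)
  \<comment> \<open>The vertices that lie in triangles: a neighbour \<open>w\<close> of such a
    vertex \<open>u\<close> sees \<open>a\<close> or \<open>b\<close> and so forms a triangle with
    it and \<open>u\<close>. Thus \<open>x\<close> lies in a triangle, and paw-freeness gives
    \<open>x\<close> and \<open>z\<close> a common neighbour \<open>c\<close>.\<close>
  define S where "S = {u \<in> V. \<exists>a\<in>V. \<exists>b\<in>V. E u a \<and> E u b \<and> E a b}"
  have "S = V"
  proof (rule conn_graphD[OF conn])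
    show "s \<in> S" using tri by (auto simp: S_def)
    fix u w assume u: "u \<in> S" and w: "w \<in> V" "E u w"
    then obtain a b where ab: "u \<in> V" "a \<in> V" "b \<in> V" "E u a" "E u b" "E a b" by (auto simp: S_def)
    have "E w a \<or> E w b" using paw_free[of u a b w] ab w by blast
    moreover have "E w u" using w comm by blast
    ultimately show "w \<in> S" using ab w unfolding S_def by blast
  qed (auto simp: S_def)
  then have "x \<in> S" using xyz(1) by simp
  then obtain a b where ab: "a \<in> V" "b \<in> V" "E x a" "E x b" "E a b" by (auto simp: S_def)
  have "E z a \<or> E z b" using paw_free[of x a b z] ab xyz \<open>E x z\<close> by blast
  then obtain c where c: "c \<in> V" "E x c" "E z c" using ab by blast
  \<comment> \<open>The vertices of triangles that \<open>y\<close> does not see at all. The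
    triangle \<open>x\<close>, \<open>z\<close>, \<open>c\<close> is one, and by \<open>far\<close>
    the property passes to neighbours; it would thus reach \<open>y\<close> itself, which sees the
    other vertices of its triangles.\<close>
  define U where "U = {u \<in> V. \<not> E u y \<and> (\<exists>a\<in>V. \<exists>b\<in>V. E u a \<and> E u b \<and> E a b \<and> \<not> E a y \<and> \<not> E b y)}"
  \<comment> \<open>Otherwise \<open>y\<close> is attached to the triangle \<open>w\<close>,
    \<open>u\<close>, \<open>p\<close> at \<open>w\<close> only, which is a paw.\<close>
  have far: "\<not> E w y" if "w \<in> V" "u \<in> V" "p \<in> V" "E w u" "E w p" "E u p" "\<not> E u y" "\<not> E p y" for w u p
    using paw_free[of w u p y] that xyz(2) comm[of y] by blast
  have "U = V"
  proof (rule conn_graphD[OF conn])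
    have "\<not> E z y" using xyz(5) comm by blast
    moreover have "\<not> E c y"
      using far[of c x z] c xyz \<open>\<not> E z y\<close> \<open>E x z\<close> comm[of c] by blast
    ultimately show "x \<in> U" using xyz c \<open>E x z\<close> unfolding U_def by blast
    fix u w assume u: "u \<in> U" and w: "w \<in> V" "E u w"
    then obtain a b where ab: "u \<in> V" "a \<in> V" "b \<in> V" "E u a" "E u b" "E a b" "\<not> E u y" "\<not> E a y" "\<not> E b y"
      by (auto simp: U_def)
    have wu: "E w u" using w comm by blast
    have "E w a \<or> E w b" using paw_free[of u a b w] ab w by blast
    then obtain p where p: "p \<in> V" "E w p" "E u p" "\<not> E p y" using ab by blast
    have "\<not> E w y" using far[of w u p] w wu p ab by blast
    then show "w \<in> U" using w wu p ab unfolding U_def by blast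
  qed (auto simp: U_def)
  then have "y \<in> U" using xyz(2) by simp
  then obtain a where "E y a" "\<not> E a y" by (auto simp: U_def)
  then show False using comm by blast
qed

text \<open>In a component with a triangle non-adjacency is transitive; any other component is
  triangle-free, which supplies the non-edges inside the chair. If \<open>q\<close> is
  \<open>a\<close> or \<open>b\<close>, the conclusion of \<open>paw_free\<close> holds by
  \<open>E a b\<close>, so that assumption excludes paws only.\<close>

lemma width_le_paw_free_p1_chair_free:
  assumes fin: "finite V" and sym: "symp E" and irr: "\<And>u. \<not> E u u"
    and paw_free: "\<And>p a b q. p \<in> V \<Longrightarrow> a \<in> V \<Longrightarrow> b \<in> V \<Longrightarrow> q \<in> V \<Longrightarrow>
      E p a \<Longrightarrow> E p b \<Longrightarrow> E a b \<Longrightarrow> E p q \<Longrightarrow> E q a \<or> E q b"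
    and p1_chair_free: "\<And>z x a b c d. z \<in> V \<Longrightarrow> x \<in> V \<Longrightarrow> a \<in> V \<Longrightarrow> b \<in> V \<Longrightarrow> c \<in> V \<Longrightarrow> d \<in> V \<Longrightarrow> a \<noteq> b \<Longrightarrow>
      E x a \<Longrightarrow> E x b \<Longrightarrow> E x c \<Longrightarrow> E c d \<Longrightarrow> \<not> E a d \<Longrightarrow> \<not> E b d \<Longrightarrow> \<not> E x d \<Longrightarrow>
      \<not> E a b \<Longrightarrow> \<not> E a c \<Longrightarrow> \<not> E b c \<Longrightarrow>
      \<not> E z x \<Longrightarrow> \<not> E z a \<Longrightarrow> \<not> E z b \<Longrightarrow> \<not> E z c \<Longrightarrow> \<not> E z d \<Longrightarrow> False"
  shows "width_le V E (256 * (2 ^ 18 * 18) * (16 + 1))"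
proof (rule width_le_components[OF fin sym])
  fix U assume U: "U \<subseteq> V" "conn_graph U E"
  have finU: "finite U" using U fin finite_subset by blast
  show "width_le U E (256 * (2 ^ 18 * 18) * (16 + 1))"
  proof (cases "\<exists>s\<in>U. \<exists>t\<in>U. \<exists>r\<in>U. E s t \<and> E s r \<and> E t r")
    case True
    then obtain s t r where tri: "s \<in> U" "t \<in> U" "r \<in> U" "E s t" "E s r" "E t r" by blast
    have "width_le U E 1"
    proof (rule width_le_nonadjacency_transitive[OF finU sym])
      fix x y z assume xyz: "x \<in> U" "y \<in> U" "z \<in> U" "\<not> E x y" "\<not> E y z"
      show "\<not> E x z"
      proof (rule paw_free_nonadjacency_transitive[OF sym U(2) _ tri xyz])
        fix p a b q
        assume "p \<in> U" "a \<in> U" "b \<in> U" "q \<in> U" "E p a" "E p b" "E a b" "E p q"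
        then show "E q a \<or> E q b" using paw_free[of p a b q] U(1) by blast
      qed
    qed
    then show ?thesis by (rule width_le_mono) simp
  next
    case False
    have no: "\<not> (E s t \<and> E s r \<and> E t r)" if "s \<in> U" "t \<in> U" "r \<in> U" for s t r using False that by blast
    interpret p1_chair_free_graph U E
    proof
      show "finite U" "symp E" "\<And>u. \<not> E u u" by fact+
      fix u v w assume "u \<in> U" "v \<in> U" "w \<in> U" "E u v" "E v w" "E u w"
      then show False using no by blast
    next
      fix z x a b c d
      assume *: "z \<in> U" "x \<in> U" "a \<in> U" "b \<in> U" "c \<in> U" "d \<in> U" "a \<noteq> b" "E x a" "E x b" "E x c" "E c d"
        "\<not> E a d" "\<not> E b d" "\<not> E z x" "\<not> E z a" "\<not> E z b" "\<not> E z c" "\<not> E z d"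
      have "\<not> E a b" "\<not> E a c" "\<not> E b c" using no[of x a b] no[of x a c] no[of x b c] * by blast+
      moreover have "\<not> E x d" using no[of x c d] * by blast
      moreover have "z \<in> V" "x \<in> V" "a \<in> V" "b \<in> V" "c \<in> V" "d \<in> V" using * U(1) by blast+
      ultimately show False using p1_chair_free[of z x a b c d] * by blast
    qed
    show ?thesis by (rule width_le_triangle_free)
  qed
qed

section \<open>Forbidden induced subgraphs\<close>

lemma not_induced_free_of_embedding:
  assumes G: "pair_wf_digraph G" and H: "pair_wf_digraph H"
    and inj: "inj_on f (pverts H)" and sub: "f ` pverts H \<subseteq> pverts G"
    and arcs: "\<And>u w. u \<in> pverts H \<Longrightarrow> w \<in> pverts H \<Longrightarrow> (f u, f w) \<in> parcs G \<longleftrightarrow> (u, w) \<in> parcs H"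
  shows "\<not> induced_free H G"
proof -
  let ?W = "f ` pverts H"
  define K where "K = \<lparr>pverts = ?W, parcs = parcs G \<inter> ?W \<times> ?W\<rparr>"
  have wfK: "pair_wf_digraph K" by unfold_locales (auto simp: K_def)
  have ind: "induced_subgraph (with_proj K) (with_proj G)"
    using sub G wfK by (auto simp: induced_subgraph_def subgraph_def wf_digraph_wp_iff K_def)
  \<comment> \<open>\<open>digraph_iso\<close> leads from the induced subgraph to \<open>H\<close>,
    so the isomorphism is built from the inverse of \<open>f\<close>.\<close>
  define g where "g = the_inv_into (pverts H) f"
  have gf: "g (f u) = u" if "u \<in> pverts H" for u using inj that by (simp add: g_def the_inv_into_f_f)
  have HV: "u \<in> pverts H" "w \<in> pverts H" if "(u, w) \<in> parcs H" for u w
    using that pair_wf_digraph.arc_fst_in_verts[OF H] pair_wf_digraph.arc_snd_in_verts[OF H] by force+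
  have inj_g: "inj_on g ?W" using gf by (auto intro!: inj_onI)
  have parcsK: "parcs K = map_prod f f ` parcs H"
    using arcs HV by (force simp: K_def)
  define iso where "iso = \<lparr>iso_verts = g, iso_arcs = map_prod g g, iso_head = snd, iso_tail = fst\<rparr>"
  have "pre_digraph.digraph_isomorphism (with_proj K) iso"
    unfolding pre_digraph.digraph_isomorphism_def
  proof (intro conjI ballI)
    show "wf_digraph (with_proj K)" using wfK by (simp add: wf_digraph_wp_iff)
    show "inj_on (iso_verts iso) (verts (with_proj K))" using inj_g by (simp add: iso_def K_def)
    show "inj_on (iso_arcs iso) (arcs (with_proj K))"
      using inj_on_subset[OF map_prod_inj_on[OF inj_g inj_g]] by (simp add: iso_def K_def)
  qed (auto simp: iso_def)
  moreover have "with_proj H = app_iso iso (with_proj K)"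
  proof -
    have "map_prod g g (map_prod f f e) = e" if "e \<in> parcs H" for e
      using that gf HV by (cases e) simp
    then have "map_prod g g ` parcs K = parcs H"
      by (simp add: parcsK image_image cong: image_cong_simp)
    moreover have "g ` pverts K = pverts H"
      using gf by (simp add: K_def image_image cong: image_cong_simp)
    ultimately show ?thesis by (simp add: app_iso_def iso_def with_proj_def)
  qed
  ultimately show ?thesis using ind unfolding induced_free_def digraph_iso_def by blast
qed

lemma parcs_path_graph_1: "parcs (path_graph 1) = {}"
  by (auto simp: path_graph_def)

lemma paw_free_of_induced_free:
  assumes G: "pair_graph G"
    and free: "induced_free (graph_complement (disjoint_union (path_graph 1) (path_graph 3))) G"
    and V: "p \<in> pverts G" "a \<in> pverts G" "b \<in> pverts G" "q \<in> pverts G"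
    and adj: "(p, a) \<in> parcs G" "(p, b) \<in> parcs G" "(a, b) \<in> parcs G" "(p, q) \<in> parcs G"
  shows "(q, a) \<in> parcs G \<or> (q, b) \<in> parcs G"
proof (rule ccontr)
  assume nadj: "\<not> ?thesis"
  interpret pair_graph G by fact
  let ?H = "graph_complement (disjoint_union (path_graph 1) (path_graph 3))"
  have comm: "(u, w) \<in> parcs G \<longleftrightarrow> (w, u) \<in> parcs G" and irr: "(u, u) \<notin> parcs G" for u w
    using pair_graph_symp_irrefl[OF G] by (auto dest: sympD)
  \<comment> \<open>In the complement, \<open>Inl 0\<close> sees the whole path and becomes
    \<open>p\<close>. The ends 0 and 2 of the path become adjacent and give \<open>a\<close> and
    \<open>b\<close>; its middle vertex 1 becomes the pendant vertex \<open>q\<close>.\<close>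
  define f :: "nat + nat \<Rightarrow> 'a" where
    "f = case_sum (\<lambda>_. p) (\<lambda>i. if i = 0 then a else if i = 1 then q else b)"
  have V3: "{..<3::nat} = {0, 1, 2}" by auto
  have "parcs (path_graph 3) = {(u, w). u \<in> {0, 1, 2} \<and> w \<in> {0, 1, 2} \<and> (w = Suc u \<or> u = Suc w)}"
    unfolding V3[symmetric] by (simp add: path_graph_def)
  also have "\<dots> = {(0, 1), (1, 0), (1, 2), (2, 1)}" by auto
  finally have P3: "parcs (path_graph 3) = {(0, 1), (1, 0), (1, 2), (2, 1)}" .
  have uverts: "pverts (disjoint_union (path_graph 1) (path_graph 3)) = {Inl 0, Inr 0, Inr 1, Inr 2}"
    by (auto simp: disjoint_union_def path_graph_def V3)
  have uarcs: "parcs (disjoint_union (path_graph 1) (path_graph 3)) =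
      {(Inr 0, Inr 1), (Inr 1, Inr 0), (Inr 1, Inr 2), (Inr 2, Inr 1)}"
    unfolding disjoint_union_def P3 parcs_path_graph_1 by simp
  have verts: "pverts ?H = {Inl 0, Inr 0, Inr 1, Inr 2}"
    unfolding graph_complement_def uverts by simp
  have arcs: "parcs ?H = {(Inl 0, Inr 0), (Inl 0, Inr 1), (Inl 0, Inr 2), (Inr 0, Inl 0), (Inr 1, Inl 0),
      (Inr 2, Inl 0), (Inr 0, Inr 2), (Inr 2, Inr 0)}"
    unfolding graph_complement_def uverts uarcs by auto
  have ne: "p \<noteq> a" "p \<noteq> b" "p \<noteq> q" "a \<noteq> b" "a \<noteq> q" "b \<noteq> q" using adj nadj irr comm by metis+
  have adj': "(a, p) \<in> parcs G" "(b, p) \<in> parcs G" "(b, a) \<in> parcs G" "(q, p) \<in> parcs G"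
    using adj comm by blast+
  have nadj': "(q, a) \<notin> parcs G" "(q, b) \<notin> parcs G" "(a, q) \<notin> parcs G" "(b, q) \<notin> parcs G"
    using nadj comm by blast+
  have "\<not> induced_free ?H G"
  proof (rule not_induced_free_of_embedding[where f = f])
    show "pair_wf_digraph G" by unfold_locales
    show "pair_wf_digraph ?H" by (unfold_locales, unfold verts arcs) auto
    show "inj_on f (pverts ?H)" unfolding verts f_def using ne by (simp add: inj_on_def)
    show "f ` pverts ?H \<subseteq> pverts G" unfolding verts f_def using V by simp
    fix u w assume "u \<in> pverts ?H" "w \<in> pverts ?H"
    then show "(f u, f w) \<in> parcs G \<longleftrightarrow> (u, w) \<in> parcs ?H"
      unfolding verts arcs by (elim insertE emptyE) (simp_all add: f_def adj adj' nadj' irr)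
  qed
  then show False using free by blast
qed

lemma pverts_S_graph_112: "pverts (S_graph 1 1 2) = {(0, 0), (1, 1), (2, 1), (3, 1), (3, 2)}"
proof -
  have "{1..2::nat} = {1, 2}" by auto
  then show ?thesis by (auto simp: S_graph_def Let_def)
qed

lemma in_parcs_S_graph:
  "((l, m), (l', m')) \<in> parcs (S_graph i j k) \<longleftrightarrow>
    (l, m) \<in> pverts (S_graph i j k) \<and> (l', m') \<in> pverts (S_graph i j k) \<and>
    (l = 0 \<and> m = 0 \<and> m' = 1 \<or> l = l' \<and> 1 \<le> m \<and> m' = Suc m \<or>
     l' = 0 \<and> m' = 0 \<and> m = 1 \<or> l = l' \<and> 1 \<le> m' \<and> m = Suc m')"
proof -
  let ?E = "{((0, 0), (l, 1)) | l. True} \<union> {((l, d), (l, Suc d)) | l d. 1 \<le> d}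
    :: ((nat \<times> nat) \<times> (nat \<times> nat)) set"
  have "((l, m), (l', m')) \<in> ?E \<union> ?E\<inverse> \<longleftrightarrow>
    (l = 0 \<and> m = 0 \<and> m' = 1 \<or> l = l' \<and> 1 \<le> m \<and> m' = Suc m \<or>
     l' = 0 \<and> m' = 0 \<and> m = 1 \<or> l = l' \<and> 1 \<le> m' \<and> m = Suc m')"
    by auto
  moreover have "parcs (S_graph i j k) = (?E \<union> ?E\<inverse>) \<inter> pverts (S_graph i j k) \<times> pverts (S_graph i j k)"
    by (simp only: S_graph_def Let_def pair_pre_digraph.select_convs)
  ultimately show ?thesis by (simp only: Int_iff mem_Sigma_iff conj_ac)
qed

lemma parcs_S_graph_112:
  "parcs (S_graph 1 1 2) = {((0, 0), (1, 1)), ((0, 0), (2, 1)), ((0, 0), (3, 1)), ((3, 1), (3, 2)),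
    ((1, 1), (0, 0)), ((2, 1), (0, 0)), ((3, 1), (0, 0)), ((3, 2), (3, 1))}" (is "_ = ?A")
proof
  show "?A \<subseteq> parcs (S_graph 1 1 2)"
    unfolding insert_subset in_parcs_S_graph pverts_S_graph_112 by simp
  show "parcs (S_graph 1 1 2) \<subseteq> ?A"
  proof (rule subrelI, unfold split_paired_all)
    fix l m l' m' assume "((l, m), (l', m')) \<in> parcs (S_graph 1 1 2)"
    then have "(l, m) \<in> pverts (S_graph 1 1 2)" "(l', m') \<in> pverts (S_graph 1 1 2)"
      "l = 0 \<and> m = 0 \<and> m' = 1 \<or> l = l' \<and> 1 \<le> m \<and> m' = Suc m \<or>
       l' = 0 \<and> m' = 0 \<and> m = 1 \<or> l = l' \<and> 1 \<le> m' \<and> m = Suc m'"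
      unfolding in_parcs_S_graph by blast+
    then show "((l, m), (l', m')) \<in> ?A"
      unfolding pverts_S_graph_112 by (elim insertE emptyE) simp_all
  qed
qed

lemma p1_chair_free_of_induced_free:
  assumes G: "pair_graph G"
    and free: "induced_free (disjoint_union (path_graph 1) (S_graph 1 1 2)) G"
    and V: "z \<in> pverts G" "x \<in> pverts G" "a \<in> pverts G" "b \<in> pverts G" "c \<in> pverts G" "d \<in> pverts G"
    and adj: "a \<noteq> b" "(x, a) \<in> parcs G" "(x, b) \<in> parcs G" "(x, c) \<in> parcs G" "(c, d) \<in> parcs G"
    and nadj: "(a, d) \<notin> parcs G" "(b, d) \<notin> parcs G" "(x, d) \<notin> parcs G" "(a, b) \<notin> parcs G"
      "(a, c) \<notin> parcs G" "(b, c) \<notin> parcs G" "(z, x) \<notin> parcs G" "(z, a) \<notin> parcs G"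
      "(z, b) \<notin> parcs G" "(z, c) \<notin> parcs G" "(z, d) \<notin> parcs G"
  shows False
proof -
  interpret pair_graph G by fact
  let ?H = "disjoint_union (path_graph 1) (S_graph 1 1 2)"
  have comm: "(u, w) \<in> parcs G \<longleftrightarrow> (w, u) \<in> parcs G" and irr: "(u, u) \<notin> parcs G" for u w
    using pair_graph_symp_irrefl[OF G] by (auto dest: sympD)
  define f :: "nat + nat \<times> nat \<Rightarrow> 'a" where
    "f = case_sum (\<lambda>_. z) (\<lambda>i. if i = (0, 0) then x else if i = (1, 1) then a else
      if i = (2, 1) then b else if i = (3, 1) then c else d)"
  have verts: "pverts ?H = {Inl 0, Inr (0, 0), Inr (1, 1), Inr (2, 1), Inr (3, 1), Inr (3, 2)}"
    unfolding disjoint_union_def pverts_S_graph_112 by (auto simp: path_graph_def)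
  have arcs: "parcs ?H = {(Inr (0, 0), Inr (1, 1)), (Inr (0, 0), Inr (2, 1)), (Inr (0, 0), Inr (3, 1)),
      (Inr (3, 1), Inr (3, 2)), (Inr (1, 1), Inr (0, 0)), (Inr (2, 1), Inr (0, 0)),
      (Inr (3, 1), Inr (0, 0)), (Inr (3, 2), Inr (3, 1))}"
    unfolding disjoint_union_def parcs_S_graph_112 parcs_path_graph_1 by simp
  have adj': "(a, x) \<in> parcs G" "(b, x) \<in> parcs G" "(c, x) \<in> parcs G" "(d, c) \<in> parcs G"
    using adj comm by blast+
  have nadj': "(d, a) \<notin> parcs G" "(d, b) \<notin> parcs G" "(d, x) \<notin> parcs G" "(b, a) \<notin> parcs G"
      "(c, a) \<notin> parcs G" "(c, b) \<notin> parcs G" "(x, z) \<notin> parcs G" "(a, z) \<notin> parcs G"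
      "(b, z) \<notin> parcs G" "(c, z) \<notin> parcs G" "(d, z) \<notin> parcs G"
    using nadj comm by blast+
  have ne: "z \<noteq> x" "z \<noteq> a" "z \<noteq> b" "z \<noteq> c" "z \<noteq> d" "x \<noteq> a" "x \<noteq> b" "x \<noteq> c" "x \<noteq> d"
    "a \<noteq> c" "a \<noteq> d" "b \<noteq> c" "b \<noteq> d" "c \<noteq> d"
    using adj adj' nadj nadj' irr by metis+
  have "\<not> induced_free ?H G"
  proof (rule not_induced_free_of_embedding[where f = f])
    show "pair_wf_digraph G" by unfold_locales
    show "pair_wf_digraph ?H" by (unfold_locales, unfold verts arcs) auto
    show "inj_on f (pverts ?H)" unfolding verts f_def using ne adj(1) by (simp add: inj_on_def)
    show "f ` pverts ?H \<subseteq> pverts G" unfolding verts f_def using V by simp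
    fix u w assume "u \<in> pverts ?H" "w \<in> pverts ?H"
    then show "(f u, f w) \<in> parcs G \<longleftrightarrow> (u, w) \<in> parcs ?H"
      unfolding verts arcs by (elim insertE emptyE) (simp_all add: f_def adj adj' nadj nadj' irr)
  qed
  then show False using free by blast
qed

theorem theorem1:
  shows "bounded_clique_width
    {G :: 'a pair_pre_digraph. pair_graph G \<and>
       induced_free (graph_complement (disjoint_union (path_graph 1) (path_graph 3))) G \<and>
       induced_free (disjoint_union (path_graph 1) (S_graph 1 1 2)) G}"
  unfolding bounded_clique_width_def
proof (intro exI ballI)
  fix G :: "'a pair_pre_digraph"
  assume "G \<in> {G. pair_graph G \<and>
       induced_free (graph_complement (disjoint_union (path_graph 1) (path_graph 3))) G \<and>
       induced_free (disjoint_union (path_graph 1) (S_graph 1 1 2)) G}"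
  then have G: "pair_graph G"
    and paw: "induced_free (graph_complement (disjoint_union (path_graph 1) (path_graph 3))) G"
    and chair: "induced_free (disjoint_union (path_graph 1) (S_graph 1 1 2)) G" by simp_all
  interpret pair_graph G by fact
  have "width_le (pverts G) (\<lambda>u w. (u, w) \<in> parcs G) (256 * (2 ^ 18 * 18) * (16 + 1))"
    by (rule width_le_paw_free_p1_chair_free[OF pair_finite_verts pair_graph_symp_irrefl[OF G]
          paw_free_of_induced_free[OF G paw] p1_chair_free_of_induced_free[OF G chair]])
  then show "clique_width G \<le> 3 * (256 * (2 ^ 18 * 18) * (16 + 1) + 1)"
    by (rule clique_width_le_of_width_le[OF G])
qed

end
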